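(* Let $a>0$ and $u_0\in L^2(\mathbb{R})$. The solution of the heat Cauchy problem associated to the real Dirac operator $d^a_x=\frac{\partial}{\partial x}-ax$, $$\begin{cases} d^a_x u(t,x)=\frac{\partial}{\partial t}u(t,x), & (t,x)\in(0,\infty)\times\mathbb{R},\\ u(0,x)=u_0(x), & x\in\mathbb{R},\end{cases}$$ is given by the formula $$u(t,x)=e^{-axt}\,e^{-\frac{at^2}{2}}\,u_0(x+t).$$ *)

theory Defs
  imports "HOL-Analysis.Analysis"
begin

text \<open>
  A datum in $L^2(\mathbb{R})$ has no pointwise derivative in general, so the equation
  $d^a_x u = \partial_t u$ is read in the sense of distributions on $(0,\infty)\times\mathbb{R}$.
  Elements of $L^2$ are represented by Borel functions, equality being almost everywhere.
\<close>

definition square_integrable_on :: "real set \<Rightarrow> (real \<Rightarrow> complex) \<Rightarrow> bool" where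
  "square_integrable_on S f \<longleftrightarrow>
     set_borel_measurable lborel S f \<and> set_integrable lborel S (\<lambda>x. (cmod (f x))\<^sup>2)"

primrec C_k :: "nat \<Rightarrow> (real \<times> real \<Rightarrow> real) \<Rightarrow> bool" where
  "C_k 0 f \<longleftrightarrow> continuous_on UNIV f"
| "C_k (Suc n) f \<longleftrightarrow>
     (\<exists>f\<^sub>t f\<^sub>x. (\<forall>p. (f has_derivative (\<lambda>h. fst h * f\<^sub>t p + snd h * f\<^sub>x p)) (at p)) \<and>
              C_k n f\<^sub>t \<and> C_k n f\<^sub>x)"

definition test_function :: "(real \<times> real \<Rightarrow> real) \<Rightarrow> bool" where
  "test_function \<phi> \<longleftrightarrow>
     (\<forall>n. C_k n \<phi>) \<and>
     (\<exists>K. compact K \<and> K \<subseteq> {0<..} \<times> UNIV \<and> (\<forall>p. p \<notin> K \<longrightarrow> \<phi> p = 0))"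

text \<open>
  Values of \<open>u\<close> at times \<open>t < 0\<close> carry no information: they are never used below, because
  test functions and their derivatives vanish there. Real test functions suffice to determine
  a complex distribution.
\<close>

definition locally_integrable :: "(real \<Rightarrow> real \<Rightarrow> complex) \<Rightarrow> bool" where
  "locally_integrable u \<longleftrightarrow>
     (\<forall>K. compact K \<longrightarrow> K \<subseteq> {0<..} \<times> UNIV \<longrightarrow> set_integrable lborel K (\<lambda>(t, x). u t x))"

definition pairing :: "(real \<Rightarrow> real \<Rightarrow> complex) \<Rightarrow> (real \<times> real \<Rightarrow> real) \<Rightarrow> complex" where
  "pairing u \<phi> = (LINT p|lborel. \<phi> p *\<^sub>R u (fst p) (snd p))"

definition distr_dt :: "(real \<Rightarrow> real \<Rightarrow> complex) \<Rightarrow> (real \<times> real \<Rightarrow> real) \<Rightarrow> complex" where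
  "distr_dt u \<phi> = - pairing u (\<lambda>(t, x). deriv (\<lambda>s. \<phi> (s, x)) t)"

definition distr_dx :: "(real \<Rightarrow> real \<Rightarrow> complex) \<Rightarrow> (real \<times> real \<Rightarrow> real) \<Rightarrow> complex" where
  "distr_dx u \<phi> = - pairing u (\<lambda>(t, x). deriv (\<lambda>y. \<phi> (t, y)) x)"

definition dirac_operator ::
  "real \<Rightarrow> (real \<Rightarrow> real \<Rightarrow> complex) \<Rightarrow> (real \<times> real \<Rightarrow> real) \<Rightarrow> complex" where
  "dirac_operator a u \<phi> = distr_dx u \<phi> - pairing (\<lambda>t x. of_real (a * x) * u t x) \<phi>"

text \<open>
  The initial value is attached to the equation by continuity of $t \mapsto u(t,\cdot)$ on
  $[0,\infty)$. The target is $L^2_{\mathrm{loc}}(\mathbb{R})$ and not $L^2(\mathbb{R})$: the factor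
  $e^{-axt}$ is unbounded as $x \to -\infty$, so $u(t,\cdot)$ need not stay in $L^2(\mathbb{R})$.
\<close>

definition continuous_L2_loc :: "(real \<Rightarrow> real \<Rightarrow> complex) \<Rightarrow> bool" where
  "continuous_L2_loc u \<longleftrightarrow>
     (\<forall>K. compact K \<longrightarrow>
        (\<forall>t\<ge>0. square_integrable_on K (u t)) \<and>
        (\<forall>s\<ge>0. ((\<lambda>t. LINT x:K|lborel. (cmod (u t x - u s x))\<^sup>2) \<longlongrightarrow> 0) (at s within {0..})))"

definition dirac_heat_solution ::
  "real \<Rightarrow> (real \<Rightarrow> complex) \<Rightarrow> (real \<Rightarrow> real \<Rightarrow> complex) \<Rightarrow> bool" where
  "dirac_heat_solution a u\<^sub>0 u \<longleftrightarrow>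
     locally_integrable u \<and> continuous_L2_loc u \<and>
     (\<forall>\<phi>. test_function \<phi> \<longrightarrow> dirac_operator a u \<phi> = distr_dt u \<phi>) \<and>
     (AE x in lborel. u 0 x = u\<^sub>0 x)"

end

theory Submission imports Defs begin

text \<open>
  Let \<open>E(t,x) = exp (a x t + a t\<^sup>2/2)\<close>. Since \<open>(\<partial>\<^sub>t - \<partial>\<^sub>x) E = a x E\<close>, the substitution \<open>w = E u\<close>
  turns \<open>\<partial>\<^sub>x u - a x u = \<partial>\<^sub>t u\<close> into the transport equation \<open>\<partial>\<^sub>t w = \<partial>\<^sub>x w\<close>, whose solutions are
  constant along the characteristics \<open>x + t = const\<close>. Hence \<open>E(t,x) u(t,x) = u\<^sub>0(x + t)\<close>, which is
  the formula, because \<open>1/E\<close> is the same weight with \<open>-a\<close> in place of \<open>a\<close>. The work lies in carrying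
  this out for distributional solutions.

  Uniqueness. Let \<open>u\<close> be a solution. Testing the equation against \<open>E(t,x) \<alpha>(t) \<beta>(x + t)\<close>, where \<open>\<beta>\<close> is
  a bump function, makes every term cancel except the one with \<open>\<alpha>'\<close>, so by Fubini the moment
  \<open>F(t) = \<integral> E(t,x) \<beta>(x + t) u(t,x) dx\<close> is orthogonal to all such \<open>\<alpha>'\<close>
  (\<open>moment_orthogonal_to_derivatives\<close>). Continuity in local \<open>L\<^sup>2\<close> makes \<open>F\<close> continuous on
  \<open>[0,\<infinity>)\<close>. Choosing for \<open>\<alpha>'\<close> the difference of a bump and its translate by \<open>k\<close>, and letting
  the bumps tend to indicators of intervals, gives \<open>F(p) = F(p + k)\<close> (\<open>moment_translate\<close>), whence
  \<open>F(t) = F(0) = \<integral> \<beta> u\<^sub>0\<close> (\<open>moment_conserved\<close>). Letting \<open>\<beta>\<close> tend to the indicator of an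
  interval shows that \<open>E(t,x) u(t,x) - u\<^sub>0(x + t)\<close> has vanishing integral over every interval, so it
  vanishes almost everywhere (\<open>solution_unique\<close>).

  Existence. For the candidate \<open>u\<close> and a test function \<open>\<phi>\<close>, the substitution \<open>y = x + t\<close> and Fubini
  turn the weak equation into \<open>\<integral> u\<^sub>0(y) \<integral> d/dt (\<phi>/E)(t, y - t) dt dy = 0\<close>, where the inner integral
  vanishes because \<open>\<phi>\<close> has compact support (\<open>transported_weak_solution\<close>). Continuity into local
  \<open>L\<^sup>2\<close> (\<open>transported_continuous_L2_loc\<close>) holds for continuous data, and follows in general because
  continuous functions are dense in \<open>L\<^sup>2\<close> of an interval (\<open>L2_approx_continuous\<close>).
\<close>

section \<open>Functions of class $C^k$ on the plane\<close>

lemma C_k_Suc_imp: "C_k (Suc n) f \<Longrightarrow> C_k n f"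
proof (induction n arbitrary: f)
  case 0
  then obtain ft fx where
    "\<And>p. (f has_derivative (\<lambda>h. fst h * ft p + snd h * fx p)) (at p)" by auto
  then show ?case
    by (auto intro!: continuous_at_imp_continuous_on has_derivative_continuous)
next
  case (Suc n)
  then obtain ft fx where
    "\<And>p. (f has_derivative (\<lambda>h. fst h * ft p + snd h * fx p)) (at p)"
    "C_k (Suc n) ft" "C_k (Suc n) fx" by (subst (asm) C_k.simps(2)) blast
  with Suc.IH show ?case by (subst C_k.simps(2)) blast
qed

lemma C_k_SucI:
  assumes "\<And>p. (f has_derivative (\<lambda>h. fst h * ft p + snd h * fx p)) (at p)"
    "C_k n ft" "C_k n fx"
  shows "C_k (Suc n) f"
  using assms by auto

lemma C_k_const: "C_k n (\<lambda>p. c)"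
proof (induction n arbitrary: c)
  case (Suc n)
  have "((\<lambda>p. c) has_derivative (\<lambda>h. fst h * (\<lambda>p. 0) p + snd h * (\<lambda>p. 0) p)) (at p)" for p :: "real \<times> real"
    by simp
  then show ?case by (rule C_k_SucI) (rule Suc)+
qed simp

lemma C_k_fst: "C_k n fst"
proof (cases n)
  case (Suc m)
  have "(fst has_derivative (\<lambda>h. fst h * (\<lambda>p. 1) p + snd h * (\<lambda>p. 0) p)) (at p)" for p :: "real \<times> real"
    by (auto intro!: derivative_eq_intros)
  then show ?thesis unfolding Suc by (rule C_k_SucI) (rule C_k_const)+
qed (simp add: continuous_on_fst[OF continuous_on_id])

lemma C_k_snd: "C_k n snd"
proof (cases n)
  case (Suc m)
  have "(snd has_derivative (\<lambda>h. fst h * (\<lambda>p. 0) p + snd h * (\<lambda>p. 1) p)) (at p)" for p :: "real \<times> real"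
    by (auto intro!: derivative_eq_intros)
  then show ?thesis unfolding Suc by (rule C_k_SucI) (rule C_k_const)+
qed (simp add: continuous_on_snd[OF continuous_on_id])

lemma C_k_add: "C_k n f \<Longrightarrow> C_k n g \<Longrightarrow> C_k n (\<lambda>p. f p + g p)"
proof (induction n arbitrary: f g)
  case (Suc n)
  obtain ft fx where f:
    "\<And>p. (f has_derivative (\<lambda>h. fst h * ft p + snd h * fx p)) (at p)" "C_k n ft" "C_k n fx"
    using Suc.prems(1) by auto
  obtain gt gx where g:
    "\<And>p. (g has_derivative (\<lambda>h. fst h * gt p + snd h * gx p)) (at p)" "C_k n gt" "C_k n gx"
    using Suc.prems(2) by auto
  show ?case
  proof (rule C_k_SucI)
    show "((\<lambda>p. f p + g p) has_derivative
        (\<lambda>h. fst h * (\<lambda>p. ft p + gt p) p + snd h * (\<lambda>p. fx p + gx p) p)) (at p)" for p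
      by (rule has_derivative_eq_rhs[OF has_derivative_add[OF f(1) g(1)]]) (auto simp: algebra_simps)
  qed (intro Suc.IH f g)+
qed (simp add: continuous_on_add)

lemma C_k_mult: "C_k n f \<Longrightarrow> C_k n g \<Longrightarrow> C_k n (\<lambda>p. f p * g p)"
proof (induction n arbitrary: f g)
  case (Suc n)
  obtain ft fx where f:
    "\<And>p. (f has_derivative (\<lambda>h. fst h * ft p + snd h * fx p)) (at p)" "C_k n ft" "C_k n fx"
    using Suc.prems(1) by auto
  obtain gt gx where g:
    "\<And>p. (g has_derivative (\<lambda>h. fst h * gt p + snd h * gx p)) (at p)" "C_k n gt" "C_k n gx"
    using Suc.prems(2) by auto
  note fg = C_k_Suc_imp[OF Suc.prems(1)] C_k_Suc_imp[OF Suc.prems(2)]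
  show ?case
  proof (rule C_k_SucI)
    show "((\<lambda>p. f p * g p) has_derivative
        (\<lambda>h. fst h * (\<lambda>p. f p * gt p + ft p * g p) p + snd h * (\<lambda>p. f p * gx p + fx p * g p) p)) (at p)" for p
      by (rule has_derivative_eq_rhs[OF has_derivative_mult[OF f(1) g(1)]]) (auto simp: algebra_simps)
  qed (intro Suc.IH C_k_add f g fg)+
qed (simp add: continuous_on_mult)

text \<open>
  A smooth function of one real variable, given together with all its derivatives: \<open>h k\<close> is the
  \<open>k\<close>-th derivative of \<open>h 0\<close>.
\<close>

definition smooth_tower :: "(nat \<Rightarrow> real \<Rightarrow> real) \<Rightarrow> bool" where
  "smooth_tower h \<longleftrightarrow> (\<forall>k x. (h k has_real_derivative h (Suc k) x) (at x))"

lemma C_k_compose: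
  assumes h: "smooth_tower h" and g: "\<And>n. C_k n g"
  shows "C_k n (\<lambda>p. h k (g p))"
proof (induction n arbitrary: k)
  case 0
  have "continuous_on UNIV (h k)"
    using h by (auto simp: smooth_tower_def intro!: continuous_at_imp_continuous_on DERIV_isCont)
  then show ?case
    using g[of 0] by (auto intro: continuous_on_compose2)
next
  case (Suc n)
  obtain gt gx where g':
    "\<And>p. (g has_derivative (\<lambda>h. fst h * gt p + snd h * gx p)) (at p)" "C_k n gt" "C_k n gx"
    using g[of "Suc n"] by auto
  have h': "(h k has_derivative (\<lambda>y. y * h (Suc k) x)) (at x)" for x
  proof -
    have "(h k has_derivative (*) (h (Suc k) x)) (at x)"
      using h by (auto simp: smooth_tower_def has_field_derivative_def)
    then show ?thesis
      by (rule has_derivative_eq_rhs) (auto simp: mult.commute)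
  qed
  show ?case
  proof (rule C_k_SucI)
    show "((\<lambda>p. h k (g p)) has_derivative
        (\<lambda>y. fst y * (\<lambda>p. h (Suc k) (g p) * gt p) p + snd y * (\<lambda>p. h (Suc k) (g p) * gx p) p)) (at p)" for p
      by (rule has_derivative_eq_rhs[OF has_derivative_compose[OF g'(1) h']]) (auto simp: algebra_simps)
  qed (intro Suc.IH C_k_mult g')+
qed

lemma smooth_tower_exp: "smooth_tower (\<lambda>k. exp)"
  by (auto simp: smooth_tower_def)

section \<open>Smooth bump functions\<close>

text \<open>
  The functions \<open>p(1/x) exp(-1/x)\<close>, extended by zero to \<open>x \<le> 0\<close>. This family is closed under
  differentiation, and contains all derivatives of \<open>exp(-1/x)\<close>; \<open>flat_deriv\<close> is the induced map
  on the polynomials \<open>p\<close>.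
\<close>

definition flat_poly :: "real poly \<Rightarrow> real \<Rightarrow> real" where
  "flat_poly p x = (if x > 0 then poly p (1 / x) * exp (- (1 / x)) else 0)"

definition flat_deriv :: "real poly \<Rightarrow> real poly" where
  "flat_deriv p = [:0, 0, 1:] * (p - pderiv p)"

lemma poly_times_exp_tendsto_0: "((\<lambda>y. poly p y * exp (- y)) \<longlongrightarrow> (0::real)) at_top"
proof -
  have "((\<lambda>y. \<Sum>i\<le>degree p. coeff p i * (y ^ i / exp y)) \<longlongrightarrow> (\<Sum>i\<le>degree p. coeff p i * 0)) at_top"
    by (intro tendsto_intros tendsto_power_div_exp_0)
  moreover have "(\<lambda>y. \<Sum>i\<le>degree p. coeff p i * (y ^ i / exp y)) = (\<lambda>y. poly p y * exp (- y))"
    by (auto simp: poly_altdef exp_minus sum_distrib_right divide_inverse mult.assoc)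
  ultimately show ?thesis by simp
qed

lemma flat_poly_derivative:
  "(flat_poly p has_real_derivative flat_poly (flat_deriv p) x) (at x)"
proof -
  consider "x > 0" | "x < 0" | "x = 0" by linarith
  then show ?thesis
  proof cases
    case 1
    have "((\<lambda>x. poly p (1 / x) * exp (- (1 / x))) has_real_derivative flat_poly (flat_deriv p) x) (at x)"
      using 1 by (auto intro!: derivative_eq_intros poly_DERIV[THEN DERIV_chain2]
          simp: flat_poly_def flat_deriv_def field_simps power2_eq_square)
    then show ?thesis
      by (rule has_field_derivative_transform_within_open[of _ _ _ "{0<..}"])
        (use 1 in \<open>auto simp: flat_poly_def\<close>)
  next
    case 2
    have "((\<lambda>x. 0) has_real_derivative flat_poly (flat_deriv p) x) (at x)"
      using 2 by (auto simp: flat_poly_def)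
    then show ?thesis
      by (rule has_field_derivative_transform_within_open[of _ _ _ "{..<0}"])
        (use 2 in \<open>auto simp: flat_poly_def\<close>)
  next
    case 3
    have "((\<lambda>h. poly ([:0, 1:] * p) (1 / h) * exp (- (1 / h))) \<longlongrightarrow> 0) (at_right 0)"
      using filterlim_compose[OF poly_times_exp_tendsto_0[of "[:0, 1:] * p"] filterlim_inverse_at_top_right]
      by (simp add: inverse_eq_divide del: mult_pCons_left)
    then have R: "((\<lambda>h. flat_poly p h / h) \<longlongrightarrow> 0) (at_right 0)"
      by (rule Lim_transform_eventually)
        (auto simp: flat_poly_def eventually_at_filter field_simps)
    have L: "((\<lambda>h. flat_poly p h / h) \<longlongrightarrow> 0) (at_left 0)"
      by (rule Lim_transform_eventually[OF tendsto_const])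
        (auto simp: flat_poly_def eventually_at_filter field_simps)
    have "(\<lambda>h. flat_poly p h / h) \<midarrow>0\<rightarrow> 0"
      using R L by (simp add: filterlim_at_split)
    then show ?thesis
      unfolding 3 DERIV_def by (simp add: flat_poly_def)
  qed
qed

text \<open>
  The smooth function \<open>exp(-1/x)\<close>, extended by zero to \<open>x \<le> 0\<close>.
\<close>

definition flat :: "real \<Rightarrow> real" where
  "flat x = (if x > 0 then exp (- (1 / x)) else 0)"

lemma smooth_tower_flat: "smooth_tower (\<lambda>k. flat_poly ((flat_deriv ^^ k) 1))"
  by (auto simp: smooth_tower_def flat_poly_derivative)

lemma flat_poly_1: "flat_poly 1 = flat"
  by (auto simp: flat_poly_def flat_def)

lemma C_k_flat: "(\<And>n. C_k n g) \<Longrightarrow> C_k n (\<lambda>p. flat (g p))"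
  using C_k_compose[OF smooth_tower_flat, of g n 0] by (simp add: flat_poly_1)

text \<open>
  Smooth functions supported in \<open>[c,d]\<close> with values in \<open>[0,1]\<close> which converge pointwise to the
  indicator function of \<open>(c,d)\<close> as \<open>n \<rightarrow> \<infinity>\<close>.
\<close>

definition bump :: "nat \<Rightarrow> real \<Rightarrow> real \<Rightarrow> real \<Rightarrow> real" where
  "bump n c d x = flat (real n * (x - c)) * flat (real n * (d - x))"

lemma C_k_bump:
  assumes g: "\<And>n. C_k n g" shows "C_k n (\<lambda>p. bump m c d (g p))"
proof -
  have "C_k n (\<lambda>p. real m * (g p + (- c)))" "C_k n (\<lambda>p. real m * (d + (- 1) * g p))" for n
    by (intro C_k_mult C_k_add C_k_const g)+
  from C_k_mult[OF C_k_flat[OF this(1)] C_k_flat[OF this(2)]]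
  show ?thesis by (simp add: bump_def)
qed

lemma flat_bounds: "0 \<le> flat x" "flat x \<le> 1"
  by (auto simp: flat_def)

lemma bump_nonneg: "0 \<le> bump n c d x"
  by (simp add: bump_def flat_bounds)

lemma bump_le_indicator: "bump n c d x \<le> indicator {c..d} x"
proof (cases "x \<in> {c..d}")
  case True
  then show ?thesis by (simp add: bump_def flat_bounds mult_le_one)
next
  case False
  then have "real n * (x - c) \<le> 0 \<or> real n * (d - x) \<le> 0"
    by (auto simp: mult_le_0_iff)
  then show ?thesis by (auto simp: bump_def flat_def)
qed

lemma bump_eq_0: "x \<notin> {c..d} \<Longrightarrow> bump n c d x = 0"
  using bump_le_indicator[of n c d x] bump_nonneg[of n c d x] by auto

lemma flat_tendsto: "(\<lambda>n. flat (real n * x)) \<longlonglongrightarrow> indicator {0<..} x"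
proof (cases "x > 0")
  case True
  have "(\<lambda>n. exp (- ((1 / x) * (1 / real n)))) \<longlonglongrightarrow> exp (- ((1 / x) * 0))"
    by (intro tendsto_intros lim_1_over_n)
  then have "(\<lambda>n. exp (- (1 / (real n * x)))) \<longlonglongrightarrow> indicator {0<..} x"
    using True by (simp add: mult.commute)
  then show ?thesis
    by (rule Lim_transform_eventually)
      (use True in \<open>auto simp: flat_def eventually_at_top_linorder intro!: exI[of _ 1]\<close>)
next
  case False
  then have "flat (real n * x) = 0" for n
    by (auto simp: flat_def zero_less_mult_iff)
  with False show ?thesis by simp
qed

lemma bump_tendsto: "(\<lambda>n. bump n c d x) \<longlonglongrightarrow> indicator {c<..<d} x"
proof -
  have "(\<lambda>n. bump n c d x) \<longlonglongrightarrow> indicator {0<..} (x - c) * indicator {0<..} (d - x)"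
    unfolding bump_def by (intro tendsto_intros flat_tendsto)
  then show ?thesis by (cases "c < x"; cases "x < d") auto
qed

lemma continuous_on_flat: "continuous_on S flat"
  using flat_poly_derivative[of 1] unfolding flat_poly_1
  by (metis DERIV_isCont continuous_at_imp_continuous_on)

lemma continuous_on_bump [continuous_intros]:
  "continuous_on S g \<Longrightarrow> continuous_on S (\<lambda>x. bump n c d (g x))"
  unfolding bump_def
  by (intro continuous_intros continuous_on_compose2[OF continuous_on_flat]) auto

lemma borel_measurable_bump [measurable]: "bump n c d \<in> borel_measurable borel"
  by (intro borel_measurable_continuous_onI continuous_intros)

lemma integral_bump_tendsto:
  fixes v :: "real \<Rightarrow> complex"
  assumes v: "set_integrable lborel {c..d} v"
  shows "(\<lambda>n. LINT x|lborel. of_real (bump n c d x) * v x) \<longlonglongrightarrow> (LINT x:{c<..<d}|lborel. v x)"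
proof -
  define w where "w = (\<lambda>x. indicator {c..d} x *\<^sub>R v x)"
  have w: "integrable lborel w" using v by (simp add: set_integrable_def w_def)
  then have [measurable]: "w \<in> borel_measurable borel" by auto
  have 1: "of_real (bump n c d x) * v x = bump n c d x *\<^sub>R w x" for n x
    by (cases "x \<in> {c..d}") (auto simp: w_def bump_eq_0 scaleR_conv_of_real)
  have 2: "(LINT x:{c<..<d}|lborel. v x) = (LINT x|lborel. indicator {c<..<d} x *\<^sub>R w x)"
    unfolding set_lebesgue_integral_def w_def
    by (intro Bochner_Integration.integral_cong) (auto simp: indicator_def)
  show ?thesis unfolding 1 2
  proof (rule integral_dominated_convergence[where w="\<lambda>x. norm (w x)"])
    show "AE x in lborel. (\<lambda>n. bump n c d x *\<^sub>R w x) \<longlonglongrightarrow> indicator {c<..<d} x *\<^sub>R w x"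
      by (intro AE_I2 tendsto_intros bump_tendsto)
    have "bump n c d x \<le> 1" for n x
      using bump_le_indicator[of n c d x] by (cases "x \<in> {c..d}") auto
    then show "AE x in lborel. norm (bump n c d x *\<^sub>R w x) \<le> norm (w x)" for n
      by (intro AE_I2) (auto simp: bump_nonneg mult_left_le_one_le)
  qed (use w in auto)
qed

section \<open>Functions with vanishing interval integrals\<close>

lemma borel_eq_open_intervals:
  "(borel :: real measure) = sigma UNIV (range (\<lambda>(c, d). {c<..<d}))"
  using borel_eq_box[where 'a=real] by (simp add: box_real)

lemma AE_zero_if_interval_integrals_zero_real:
  fixes f :: "real \<Rightarrow> real"
  assumes f: "integrable lborel f"
    and zero: "\<And>c d. (LINT x:{c<..<d}|lborel. f x) = 0"
  shows "AE x in lborel. f x = 0"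
proof -
  have [measurable]: "f \<in> borel_measurable borel" using f by auto
  have si: "set_integrable lborel A f" if "A \<in> sets borel" for A
    using that f integrable_mult_indicator[of A lborel f] by (simp add: set_integrable_def)
  have total: "(LINT x|lborel. f x) = 0"
  proof -
    have "(\<lambda>n. LINT x:{- real n<..<real n}|lborel. f x) \<longlonglongrightarrow> (LINT x|lborel. f x)"
      unfolding set_lebesgue_integral_def
    proof (rule integral_dominated_convergence[where w="\<lambda>x. norm (f x)"])
      show "AE x in lborel. (\<lambda>n. indicat_real {- real n<..<real n} x *\<^sub>R f x) \<longlonglongrightarrow> f x"
      proof (intro AE_I2 tendsto_eventually)
        fix x :: real
        obtain N :: nat where "\<bar>x\<bar> < real N" using reals_Archimedean2 by blast
        then show "\<forall>\<^sub>F n in sequentially. indicat_real {- real n<..<real n} x *\<^sub>R f x = f x"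
          by (auto simp: eventually_at_top_linorder indicator_def intro!: exI[of _ N])
      qed
    qed (use f in \<open>auto simp: indicator_def\<close>)
    then show ?thesis using zero by (simp add: LIMSEQ_const_iff)
  qed
  \<comment> \<open>Open intervals form an intersection-stable generator, so the integral vanishes on every
    Borel set.\<close>
  let ?G = "range (\<lambda>(c::real, d). {c<..<d})"
  have "(LINT x:A|lborel. f x) = 0" if A: "A \<in> sets borel" for A
  proof -
    have "Int_stable ?G"
      by (fastforce simp: Int_stable_def Int_greaterThanLessThan)
    moreover have "?G \<subseteq> Pow UNIV" by simp
    moreover have "A \<in> sigma_sets UNIV ?G"
      using A unfolding borel_eq_open_intervals by (simp add: sets_measure_of)
    ultimately show ?thesis
    proof (induction rule: sigma_sets_induct_disjoint)
      case (basic A)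
      then show ?case using zero by auto
    next
      case empty
      then show ?case by (simp add: set_lebesgue_integral_def)
    next
      case (compl A)
      then have A: "A \<in> sets borel"
        unfolding borel_eq_open_intervals by (simp add: sets_measure_of)
      have "(LINT x|lborel. f x) = (LINT x:A \<union> (UNIV - A)|lborel. f x)"
        by (simp add: set_lebesgue_integral_def)
      also have "\<dots> = (LINT x:A|lborel. f x) + (LINT x:UNIV - A|lborel. f x)"
        by (rule set_integral_Un) (use A in \<open>auto intro: si\<close>)
      finally show ?case using total compl by simp
    next
      case (union A)
      then have A: "A i \<in> sets borel" for i
        unfolding borel_eq_open_intervals by (auto simp: sets_measure_of)
      have "(LINT x:(\<Union>i. A i)|lborel. f x) = (\<Sum>i. (LINT x:(A i)|lborel. f x))"
        by (rule lebesgue_integral_countable_add)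
          (use A union in \<open>auto intro!: si simp: disjoint_family_on_def\<close>)
      then show ?case using union by simp
    qed
  qed
  then show ?thesis
    using density_unique_real[of lborel f "\<lambda>x. 0"] f by auto
qed

lemma AE_zero_if_interval_integrals_zero:
  fixes v :: "real \<Rightarrow> complex"
  assumes v: "\<And>c d. set_integrable lborel {c..d} v"
    and zero: "\<And>c d. (LINT x:{c<..<d}|lborel. v x) = 0"
  shows "AE x in lborel. v x = 0"
proof -
  have "AE x in lborel. x \<in> {- real n<..<real n} \<longrightarrow> v x = 0" for n :: nat
  proof -
    define w where "w = (\<lambda>x. indicator {- real n<..<real n} x *\<^sub>R v x)"
    have vo: "set_integrable lborel {c<..<d} v" for c d
      by (rule set_integrable_subset[OF v[of c d]]) auto
    have w: "integrable lborel w"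
      using vo by (simp add: w_def set_integrable_def)
    have zw: "(LINT x|lborel. indicator {c<..<d} x *\<^sub>R w x) = 0" for c d
    proof -
      have "(\<lambda>x. indicator {c<..<d} x *\<^sub>R w x) =
          (\<lambda>x. indicator {max c (- real n)<..<min d (real n)} x *\<^sub>R v x)"
        by (auto simp: w_def indicator_def fun_eq_iff)
      then show ?thesis using zero by (simp add: set_lebesgue_integral_def)
    qed
    have iw: "integrable lborel (\<lambda>x. indicator {c<..<d} x *\<^sub>R w x)" for c d
      using integrable_mult_indicator[of "{c<..<d}" lborel w] w by simp
    have "AE x in lborel. Re (w x) = 0"
    proof (rule AE_zero_if_interval_integrals_zero_real)
      show "(LINT x:{c<..<d}|lborel. Re (w x)) = 0" for c d
        using integral_Re[OF iw[of c d]] zw[of c d] by (simp add: set_lebesgue_integral_def)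
    qed (use w in simp)
    moreover have "AE x in lborel. Im (w x) = 0"
    proof (rule AE_zero_if_interval_integrals_zero_real)
      show "(LINT x:{c<..<d}|lborel. Im (w x)) = 0" for c d
        using integral_Im[OF iw[of c d]] zw[of c d] by (simp add: set_lebesgue_integral_def)
    qed (use w in simp)
    ultimately show ?thesis
      by eventually_elim (auto simp: w_def complex_eq_iff)
  qed
  then have "AE x in lborel. \<forall>n::nat. x \<in> {- real n<..<real n} \<longrightarrow> v x = 0"
    unfolding AE_all_countable by blast
  then show ?thesis
  proof eventually_elim
    case (elim x)
    obtain N :: nat where "\<bar>x\<bar> < real N" using reals_Archimedean2 by blast
    with elim show ?case by (auto simp: abs_less_iff)
  qed
qed

section \<open>Local square integrability\<close>

lemma norm_add_square_le: "(norm (x + y :: complex))\<^sup>2 \<le> 2 * (norm x)\<^sup>2 + 2 * (norm y)\<^sup>2"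
proof -
  have "(norm (x + y))\<^sup>2 \<le> (norm x + norm y)\<^sup>2"
    by (intro power_mono norm_triangle_ineq) auto
  also have "\<dots> \<le> 2 * (norm x)\<^sup>2 + 2 * (norm y)\<^sup>2"
    using zero_le_power2[of "norm x - norm y"] by (simp add: power2_eq_square algebra_simps)
  finally show ?thesis .
qed

lemma square_integrable_imp_set_integrable:
  assumes f: "square_integrable_on {c..d} f"
  shows "set_integrable lborel {c..d} f"
  unfolding set_integrable_def
proof (rule Bochner_Integration.integrable_bound)
  show "integrable lborel (\<lambda>x. indicator {c..d} x + indicator {c..d} x *\<^sub>R (cmod (f x))\<^sup>2 :: real)"
    using f borel_integrable_compact[of "{c..d}" "\<lambda>x. 1::real"]
    by (auto simp: square_integrable_on_def set_integrable_def)
  show "(\<lambda>x. indicat_real {c..d} x *\<^sub>R f x) \<in> borel_measurable lborel"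
    using f by (simp add: square_integrable_on_def set_borel_measurable_def)
  have "y \<le> 1 + y\<^sup>2" for y :: real
    using zero_le_power2[of "y - 1"] by (sos)
  then show "AE x in lborel. norm (indicat_real {c..d} x *\<^sub>R f x)
      \<le> norm (indicator {c..d} x + indicator {c..d} x *\<^sub>R (cmod (f x))\<^sup>2 :: real)"
    by (intro AE_I2) (auto simp: indicator_def)
qed

lemma square_integrable_diff:
  assumes "S \<in> sets borel" "square_integrable_on S f" "square_integrable_on S g"
  shows "square_integrable_on S (\<lambda>x. f x - g x)"
proof -
  have m: "(\<lambda>x. indicat_real S x *\<^sub>R f x) \<in> borel_measurable borel"
    "(\<lambda>x. indicat_real S x *\<^sub>R g x) \<in> borel_measurable borel"
    using assms by (auto simp: square_integrable_on_def set_borel_measurable_def)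
  have m': "(\<lambda>x. indicat_real S x *\<^sub>R (f x - g x)) \<in> borel_measurable borel"
    unfolding scaleR_diff_right using m by measurable
  have "integrable lborel (\<lambda>x. indicat_real S x *\<^sub>R (cmod (f x - g x))\<^sup>2)"
  proof (rule Bochner_Integration.integrable_bound)
    show "integrable lborel (\<lambda>x. 2 * (indicat_real S x *\<^sub>R (cmod (f x))\<^sup>2) + 2 * (indicat_real S x *\<^sub>R (cmod (g x))\<^sup>2))"
      using assms by (auto simp: square_integrable_on_def set_integrable_def)
    have "(\<lambda>x. indicat_real S x *\<^sub>R (cmod (f x - g x))\<^sup>2) = (\<lambda>x. (cmod (indicat_real S x *\<^sub>R (f x - g x)))\<^sup>2)"
      by (auto simp: indicator_def fun_eq_iff)
    moreover have "(\<lambda>x. (cmod (indicat_real S x *\<^sub>R (f x - g x)))\<^sup>2) \<in> borel_measurable borel"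
      using m' by measurable
    ultimately show "(\<lambda>x. indicat_real S x *\<^sub>R (cmod (f x - g x))\<^sup>2) \<in> borel_measurable lborel"
      by simp
    have "(cmod (y - z))\<^sup>2 \<le> 2 * (cmod y)\<^sup>2 + 2 * (cmod z)\<^sup>2" for y z
      using norm_add_square_le[of y "- z"] by simp
    then show "AE x in lborel. norm (indicat_real S x *\<^sub>R (cmod (f x - g x))\<^sup>2)
       \<le> norm (2 * (indicat_real S x *\<^sub>R (cmod (f x))\<^sup>2) + 2 * (indicat_real S x *\<^sub>R (cmod (g x))\<^sup>2))"
      by (intro AE_I2) (auto simp: indicator_def)
  qed
  with m' show ?thesis
    by (simp add: square_integrable_on_def set_borel_measurable_def set_integrable_def)
qed

text \<open>
  On a bounded interval, convergence in mean square implies convergence in mean. Instead of the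
  Cauchy--Schwarz inequality, the elementary bound \<open>y \<le> \<delta> + y\<^sup>2/\<delta>\<close> suffices.
\<close>

lemma L2_tendsto_imp_L1_tendsto:
  fixes w :: "'b \<Rightarrow> real \<Rightarrow> complex"
  assumes sq: "\<forall>\<^sub>F t in F. square_integrable_on {c..d} (w t)"
    and lim: "((\<lambda>t. LINT x:{c..d}|lborel. (cmod (w t x))\<^sup>2) \<longlongrightarrow> 0) F"
  shows "((\<lambda>t. LINT x:{c..d}|lborel. cmod (w t x)) \<longlongrightarrow> 0) F"
proof (rule tendstoI)
  fix e :: real assume e: "e > 0"
  define L where "L = measure lborel {c..d}"
  define \<delta> where "\<delta> = e / (2 * (L + 1))"
  have L: "L \<ge> 0" by (simp add: L_def)
  then have \<delta>: "\<delta> > 0" "\<delta> * L < e / 2" using e by (auto simp: \<delta>_def field_simps)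
  have "\<forall>\<^sub>F t in F. (LINT x:{c..d}|lborel. (cmod (w t x))\<^sup>2) < \<delta> * (e / 2)"
    using order_tendstoD(2)[OF lim, of "\<delta> * (e / 2)"] \<delta> e by simp
  with sq show "\<forall>\<^sub>F t in F. dist (LINT x:{c..d}|lborel. cmod (w t x)) 0 < e"
  proof eventually_elim
    case (elim t)
    have i1: "set_integrable lborel {c..d} (\<lambda>x. cmod (w t x))"
      using square_integrable_imp_set_integrable[OF elim(1)]
      by (rule set_integrable_norm)
    have i2: "set_integrable lborel {c..d} (\<lambda>x. (cmod (w t x))\<^sup>2)"
      using elim(1) by (simp add: square_integrable_on_def)
    have i3: "set_integrable lborel {c..d} (\<lambda>x. \<delta>)"
      unfolding set_integrable_def
      by (intro borel_integrable_compact compact_Icc continuous_intros)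
    have le: "y \<le> \<delta> + y\<^sup>2 / \<delta>" for y :: real
    proof -
      have "\<delta> * y \<le> \<delta>\<^sup>2 + y\<^sup>2"
        using sum_squares_bound[of \<delta> y] zero_le_power2[of y] zero_le_power2[of \<delta>]
        by linarith
      then show ?thesis using \<delta> by (simp add: field_simps power2_eq_square)
    qed
    have "(LINT x:{c..d}|lborel. cmod (w t x)) \<le> (LINT x:{c..d}|lborel. \<delta> + (cmod (w t x))\<^sup>2 / \<delta>)"
      by (intro set_integral_mono i1 set_integral_add i2 i3 set_integrable_divide le)
    also have "\<dots> = (LINT x:{c..d}|lborel. \<delta>) + (LINT x:{c..d}|lborel. (cmod (w t x))\<^sup>2 / \<delta>)"
      by (intro set_integral_add i3 set_integrable_divide i2)
    also have "\<dots> = \<delta> * L + (LINT x:{c..d}|lborel. (cmod (w t x))\<^sup>2) / \<delta>"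
      by (simp add: L_def set_lebesgue_integral_def)
    also have "\<dots> < e / 2 + e / 2"
      using \<delta> elim(2) by (intro add_strict_mono) (auto simp: field_simps)
    finally have "(LINT x:{c..d}|lborel. cmod (w t x)) < e" by simp
    moreover have "0 \<le> (LINT x:{c..d}|lborel. cmod (w t x))"
      by (auto simp: set_lebesgue_integral_def intro!: integral_nonneg_AE)
    ultimately show ?case by simp
  qed
qed

lemma translate_set_integrable:
  fixes f :: "real \<Rightarrow> 'b::{banach, second_countable_topology}"
  assumes "\<And>c d. set_integrable lborel {c..d} f"
  shows "set_integrable lborel {c..d} (\<lambda>x. f (x + t))"
proof -
  have "integrable lborel (\<lambda>x. indicat_real {c + t..d + t} (t + 1 * x) *\<^sub>R f (t + 1 * x))"
    by (rule lborel_integrable_real_affine) (use assms[of "c + t" "d + t"] in \<open>auto simp: set_integrable_def\<close>)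
  moreover have "indicat_real {c + t..d + t} (t + 1 * x) = indicator {c..d} x" for x
    by (auto simp: indicator_def)
  ultimately show ?thesis by (simp add: set_integrable_def add.commute)
qed

lemma bounded_on_compact:
  fixes g :: "'a::topological_space \<Rightarrow> real"
  assumes "continuous_on UNIV g" "compact K"
  shows "\<exists>M. \<forall>p\<in>K. norm (g p) \<le> M"
proof -
  have "bounded (g ` K)"
    using assms continuous_on_subset[OF assms(1) subset_UNIV]
    by (intro compact_imp_bounded compact_continuous_image)
  then show ?thesis by (simp add: bounded_iff)
qed

lemma set_integrable_continuous_scaleR:
  fixes f :: "'a::euclidean_space \<Rightarrow> 'b::{banach, second_countable_topology}"
  assumes K: "compact K" and g: "continuous_on UNIV g" and f: "set_integrable lborel K f"
  shows "set_integrable lborel K (\<lambda>x. g x *\<^sub>R f x)"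
proof -
  obtain M where M: "\<And>x. x \<in> K \<Longrightarrow> norm (g x) \<le> M"
    using bounded_on_compact[OF g K] by blast
  have fK: "integrable lborel (\<lambda>x. indicator K x *\<^sub>R f x)"
    using f by (simp only: set_integrable_def)
  have gm: "g \<in> borel_measurable lborel"
    using borel_measurable_continuous_onI[OF g] by simp
  have "integrable lborel (\<lambda>x. g x *\<^sub>R (indicator K x *\<^sub>R f x))"
  proof (rule Bochner_Integration.integrable_bound)
    show "integrable lborel (\<lambda>x. M *\<^sub>R (indicator K x *\<^sub>R f x))"
      using fK by (intro integrable_scaleR_right)
    show "(\<lambda>x. g x *\<^sub>R (indicator K x *\<^sub>R f x)) \<in> borel_measurable lborel"
      by (intro borel_measurable_scaleR gm borel_measurable_integrable fK)
    show "AE x in lborel. norm (g x *\<^sub>R (indicator K x *\<^sub>R f x)) \<le> norm (M *\<^sub>R (indicator K x *\<^sub>R f x))"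
    proof (rule AE_I2)
      fix x
      show "norm (g x *\<^sub>R (indicator K x *\<^sub>R f x)) \<le> norm (M *\<^sub>R (indicator K x *\<^sub>R f x))"
        using M[of x] by (cases "x \<in> K") (auto intro!: mult_right_mono)
    qed
  qed
  then show ?thesis
    by (simp add: set_integrable_def mult.commute)
qed

lemma integrable_compact_support_scaleR:
  fixes f :: "'a::euclidean_space \<Rightarrow> 'b::{banach, second_countable_topology}"
  assumes "compact K" "continuous_on UNIV g" "set_integrable lborel K f"
    and supp: "\<And>x. x \<notin> K \<Longrightarrow> g x = 0"
  shows "integrable lborel (\<lambda>x. g x *\<^sub>R f x)"
proof -
  have "(\<lambda>x. indicator K x *\<^sub>R (g x *\<^sub>R f x)) = (\<lambda>x. g x *\<^sub>R f x)"
    using supp by (auto simp: indicator_def fun_eq_iff)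
  then show ?thesis
    using set_integrable_continuous_scaleR[OF assms(1-3)] by (simp only: set_integrable_def)
qed

section \<open>Weighted integrals of time slices\<close>

lemma slice_set_integrable:
  assumes "continuous_L2_loc u" "t \<ge> 0"
  shows "set_integrable lborel {c..d} (u t)"
  using assms compact_Icc unfolding continuous_L2_loc_def
  by (intro square_integrable_imp_set_integrable) blast

lemma weighted_slice_integrable:
  assumes u: "continuous_L2_loc u" and t: "t \<ge> 0"
    and m: "continuous_on UNIV m" and supp: "\<And>x. x \<notin> {c..d} \<Longrightarrow> m x = 0"
  shows "integrable lborel (\<lambda>x. of_real (m x) * u t x)"
  using integrable_compact_support_scaleR[OF compact_Icc m slice_set_integrable[OF u t] supp]
  by (simp add: scaleR_conv_of_real)

text \<open>
  Spatial integrals against a continuous weight are continuous in time: the change of \<open>u\<close> is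
  controlled in \<open>L\<^sup>1\<close> of a fixed interval, the change of the weight by dominated convergence.
\<close>

lemma weighted_slice_continuous:
  assumes u: "continuous_L2_loc u"
    and m: "continuous_on UNIV m"
    and supp: "\<And>t x. 0 \<le> t \<Longrightarrow> t \<le> T \<Longrightarrow> x \<notin> {c..d} \<Longrightarrow> m (t, x) = 0"
  shows "continuous_on {0..T} (\<lambda>t. LINT x|lborel. of_real (m (t, x)) * u t x)"
  unfolding continuous_on_def
proof
  fix s assume s: "s \<in> {0..T}"
  let ?F = "at s within {0..T}"
  define I where "I = (\<lambda>t. LINT x|lborel. of_real (m (t, x)) * u t x)"
  define A where "A = (\<lambda>t. LINT x|lborel. of_real (m (t, x)) * (u t x - u s x))"
  define B where "B = (\<lambda>t. LINT x|lborel. of_real (m (t, x) - m (s, x)) * u s x)"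
  have mt: "continuous_on UNIV (\<lambda>x. m (t, x))" for t
    by (intro continuous_on_compose2[OF m] continuous_intros) auto
  have int: "integrable lborel (\<lambda>x. of_real (m (t, x)) * u r x)"
    if "t \<in> {0..T}" "r \<in> {0..T}" for t r
    by (rule weighted_slice_integrable[OF u, where c=c and d=d])
      (use that supp mt in auto)
  have sq: "square_integrable_on {c..d} (u t)" if "t \<ge> 0" for t
    using u that compact_Icc unfolding continuous_L2_loc_def by blast
  have sqd: "square_integrable_on {c..d} (\<lambda>x. u t x - u s x)" if "t \<ge> 0" for t
    using square_integrable_diff[of "{c..d}" "u t" "u s"] sq that s by auto
  have split: "I t = I s + A t + B t" if t: "t \<in> {0..T}" for t
  proof -
    have "I t = (LINT x|lborel. of_real (m (s, x)) * u s x
        + (of_real (m (t, x)) * u t x - of_real (m (t, x)) * u s x)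
        + (of_real (m (t, x)) * u s x - of_real (m (s, x)) * u s x))"
      unfolding I_def by (intro Bochner_Integration.integral_cong) auto
    also have "\<dots> = I s + A t + B t"
      unfolding I_def A_def B_def using int t s
      by (simp add: algebra_simps)
    finally show ?thesis .
  qed
  obtain M where "\<forall>z\<in>{0..T} \<times> {c..d}. norm (m z) \<le> M"
    using bounded_on_compact[OF m compact_Times[OF compact_Icc[of 0 T] compact_Icc[of c d]]]
    by (elim exE)
  then have M: "norm (m (t, x)) \<le> M" if "t \<in> {0..T}" "x \<in> {c..d}" for t x
    using that by blast
  have M': "norm (m (t, x)) \<le> M * indicator {c..d} x" if "t \<in> {0..T}" for t x
    using M[OF that] supp[of t x] that by (cases "x \<in> {c..d}") auto
  have evF: "\<forall>\<^sub>F t in ?F. t \<in> {0..T}"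
    by (simp add: eventually_at_filter)
  have "(A \<longlongrightarrow> 0) ?F"
  proof (rule Lim_null_comparison)
    have "((\<lambda>t. LINT x:{c..d}|lborel. (cmod (u t x - u s x))\<^sup>2) \<longlongrightarrow> 0) (at s within {0..})"
      using u s compact_Icc[of c d] unfolding continuous_L2_loc_def by auto
    then have "((\<lambda>t. LINT x:{c..d}|lborel. (cmod (u t x - u s x))\<^sup>2) \<longlongrightarrow> 0) ?F"
      by (rule tendsto_within_subset) auto
    then have "((\<lambda>t. LINT x:{c..d}|lborel. cmod (u t x - u s x)) \<longlongrightarrow> 0) ?F"
      by (intro L2_tendsto_imp_L1_tendsto) (auto simp: eventually_at_filter sqd)
    then show "((\<lambda>t. M * (LINT x:{c..d}|lborel. cmod (u t x - u s x))) \<longlongrightarrow> 0) ?F"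
      by (rule tendsto_mult_right_zero)
    show "\<forall>\<^sub>F t in ?F. norm (A t) \<le> M * (LINT x:{c..d}|lborel. cmod (u t x - u s x))"
      using evF
    proof eventually_elim
      case (elim t)
      have i: "set_integrable lborel {c..d} (\<lambda>x. u t x - u s x)"
        using sqd[of t] elim by (intro square_integrable_imp_set_integrable) auto
      have "norm (A t) \<le> (LINT x|lborel. M * (indicator {c..d} x *\<^sub>R cmod (u t x - u s x)))"
        unfolding A_def
      proof (rule Bochner_Integration.integral_norm_bound_integral)
        show "integrable lborel (\<lambda>x. of_real (m (t, x)) * (u t x - u s x))"
          using int[OF elim elim] int[OF elim s] by (simp add: right_diff_distrib)
        show "integrable lborel (\<lambda>x. M * (indicator {c..d} x *\<^sub>R cmod (u t x - u s x)))"
          using set_integrable_norm[OF i] by (simp add: set_integrable_def)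
        show "norm (of_real (m (t, x)) * (u t x - u s x)) \<le> M * (indicator {c..d} x *\<^sub>R cmod (u t x - u s x))" for x
          using mult_right_mono[OF M'[OF elim, of x], of "cmod (u t x - u s x)"]
          by (simp add: norm_mult mult_ac)
      qed
      then show ?case by (simp add: set_lebesgue_integral_def)
    qed
  qed
  moreover have "(B \<longlongrightarrow> 0) ?F"
    unfolding tendsto_at_iff_sequentially
  proof (intro allI impI)
    fix X assume X: "\<forall>i. X i \<in> {0..T} - {s}" "X \<longlonglongrightarrow> s"
    have si: "set_integrable lborel {c..d} (u s)"
      using sq[of s] s by (intro square_integrable_imp_set_integrable) auto
    have "(\<lambda>n. LINT x|lborel. of_real (m (X n, x) - m (s, x)) * u s x) \<longlonglongrightarrow> (LINT x|(lborel::real measure). (0::complex))"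
    proof (rule integral_dominated_convergence[where w="\<lambda>x. 2 * M * (indicator {c..d} x *\<^sub>R cmod (u s x))"])
      show "integrable lborel (\<lambda>x. 2 * M * (indicator {c..d} x *\<^sub>R cmod (u s x)))"
        using set_integrable_norm[OF si] by (simp add: set_integrable_def)
      have "integrable lborel (\<lambda>x. of_real (m (X n, x)) * u s x - of_real (m (s, x)) * u s x)" for n
        using X s by (intro Bochner_Integration.integrable_diff int) auto
      then show "(\<lambda>x. of_real (m (X n, x) - m (s, x)) * u s x) \<in> borel_measurable lborel" for n
        by (simp add: left_diff_distrib borel_measurable_integrable)
      show "AE x in lborel. (\<lambda>n. of_real (m (X n, x) - m (s, x)) * u s x) \<longlonglongrightarrow> 0"
      proof (rule AE_I2)
        fix x
        have "(\<lambda>n. m (X n, x)) \<longlonglongrightarrow> m (s, x)"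
          by (rule continuous_on_tendsto_compose[OF m]) (auto intro!: tendsto_intros X)
        then have "(\<lambda>n. of_real (m (X n, x) - m (s, x)) * u s x) \<longlonglongrightarrow> of_real (m (s, x) - m (s, x)) * u s x"
          by (intro tendsto_intros)
        then show "(\<lambda>n. of_real (m (X n, x) - m (s, x)) * u s x) \<longlonglongrightarrow> 0" by simp
      qed
      show "AE x in lborel. norm (of_real (m (X n, x) - m (s, x)) * u s x) \<le> 2 * M * (indicator {c..d} x *\<^sub>R cmod (u s x))" for n
      proof (rule AE_I2)
        fix x
        have "norm (m (X n, x) - m (s, x)) \<le> 2 * M * indicator {c..d} x"
          using M'[of "X n" x] M'[of s x] X s norm_triangle_ineq4[of "m (X n, x)" "m (s, x)"] by auto
        from mult_right_mono[OF this, of "cmod (u s x)"]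
        show "norm (of_real (m (X n, x) - m (s, x)) * u s x) \<le> 2 * M * (indicator {c..d} x *\<^sub>R cmod (u s x))"
          by (simp add: norm_mult mult_ac flip: of_real_diff)
      qed
    qed auto
    then show "(B \<circ> X) \<longlonglongrightarrow> 0" by (simp add: B_def o_def)
  qed
  ultimately have "((\<lambda>t. I s + A t + B t) \<longlongrightarrow> I s + 0 + 0) ?F"
    by (intro tendsto_intros)
  moreover have "\<forall>\<^sub>F t in ?F. I s + A t + B t = I t"
    using evF by eventually_elim (simp add: split)
  ultimately have "(I \<longlongrightarrow> I s + 0 + 0) ?F"
    by (rule Lim_transform_eventually)
  then show "((\<lambda>t. LINT x|lborel. of_real (m (t, x)) * u t x) \<longlongrightarrow>
      (LINT x|lborel. of_real (m (s, x)) * u s x)) ?F"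
    by (simp add: I_def)
qed

section \<open>The weak form of the equation\<close>

lemma compactly_supported_pairing_integrable:
  assumes u: "locally_integrable u" and g: "continuous_on UNIV g"
    and K: "compact K" "K \<subseteq> {0<..} \<times> UNIV" and supp: "\<And>p. p \<notin> K \<Longrightarrow> g p = 0"
  shows "integrable lborel (\<lambda>p. g p *\<^sub>R u (fst p) (snd p))"
proof -
  have "set_integrable lborel K (\<lambda>p. u (fst p) (snd p))"
    using u K by (simp add: locally_integrable_def case_prod_beta')
  from integrable_compact_support_scaleR[OF K(1) g this supp] show ?thesis .
qed

text \<open>
  \<open>ft\<close> and \<open>fx\<close> are the partial derivatives of \<open>\<phi>\<close>, all three functions being continuous and
  supported in the compact subset \<open>K\<close> of the open half plane.
\<close>

definition compact_partials ::
  "(real \<times> real) set \<Rightarrow> (real \<times> real \<Rightarrow> real) \<Rightarrow> (real \<times> real \<Rightarrow> real) \<Rightarrow> (real \<times> real \<Rightarrow> real) \<Rightarrow> bool" where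
  "compact_partials K \<phi> ft fx \<longleftrightarrow>
     compact K \<and> K \<subseteq> {0<..} \<times> UNIV \<and>
     (\<forall>f\<in>{\<phi>, ft, fx}. continuous_on UNIV f \<and> (\<forall>p. p \<notin> K \<longrightarrow> f p = 0)) \<and>
     (\<forall>p. (\<phi> has_derivative (\<lambda>h. fst h * ft p + snd h * fx p)) (at p))"

lemma test_function_partials:
  assumes "test_function \<phi>"
  obtains K ft fx where "compact_partials K \<phi> ft fx"
proof -
  obtain K where K: "compact K" "K \<subseteq> {0<..} \<times> UNIV" and supp: "\<And>p. p \<notin> K \<Longrightarrow> \<phi> p = 0"
    using assms by (auto simp: test_function_def)
  have "C_k (Suc 0) \<phi>" "C_k 0 \<phi>" using assms by (auto simp: test_function_def simp del: C_k.simps)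
  then obtain ft fx where
    f: "\<And>p. (\<phi> has_derivative (\<lambda>h. fst h * ft p + snd h * fx p)) (at p)"
    and c: "continuous_on UNIV ft" "continuous_on UNIV fx" and c\<phi>: "continuous_on UNIV \<phi>" by auto
  have z: "(\<lambda>h. fst h * ft p + snd h * fx p) = (\<lambda>h. 0)" if "p \<notin> K" for p
  proof -
    have "(\<phi> has_derivative (\<lambda>h. 0)) (at p)"
      by (rule has_derivative_transform_within_open[of "\<lambda>p. 0" _ _ _ "- K"])
        (use that K supp in \<open>auto simp: compact_imp_closed open_Compl\<close>)
    with f show ?thesis by (rule has_derivative_unique)
  qed
  have "ft p = 0" "fx p = 0" if "p \<notin> K" for p
    using fun_cong[OF z[OF that], of "(1, 0)"] fun_cong[OF z[OF that], of "(0, 1)"] by auto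
  then have "compact_partials K \<phi> ft fx"
    using K supp f c c\<phi> by (simp add: compact_partials_def del: split_paired_All)
  then show ?thesis by (rule that)
qed

lemma weak_equation_iff:
  assumes u: "locally_integrable u" and P: "compact_partials K \<phi> ft fx"
  shows "dirac_operator a u \<phi> = distr_dt u \<phi> \<longleftrightarrow>
    (LINT p|lborel. (ft p - fx p - a * snd p * \<phi> p) *\<^sub>R u (fst p) (snd p)) = 0"
proof -
  have K: "compact K" "K \<subseteq> {0<..} \<times> UNIV"
    and c: "continuous_on UNIV \<phi>" "continuous_on UNIV ft" "continuous_on UNIV fx"
    and supp: "\<And>p. p \<notin> K \<Longrightarrow> \<phi> p = 0" "\<And>p. p \<notin> K \<Longrightarrow> ft p = 0" "\<And>p. p \<notin> K \<Longrightarrow> fx p = 0"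
    and f: "\<And>p. (\<phi> has_derivative (\<lambda>h. fst h * ft p + snd h * fx p)) (at p)"
    using P by (simp_all add: compact_partials_def del: split_paired_All)
  have dt: "deriv (\<lambda>s. \<phi> (s, x)) t = ft (t, x)" for t x
  proof (rule DERIV_imp_deriv)
    have "((\<lambda>s. (s, x)) has_derivative (\<lambda>h. (h, 0))) (at t)"
      by (auto intro!: derivative_eq_intros)
    from has_derivative_compose[OF this f]
    show "((\<lambda>s. \<phi> (s, x)) has_real_derivative ft (t, x)) (at t)"
      unfolding has_field_derivative_def by (rule has_derivative_eq_rhs) auto
  qed
  have dx: "deriv (\<lambda>y. \<phi> (t, y)) x = fx (t, x)" for t x
  proof (rule DERIV_imp_deriv)
    have "((\<lambda>y. (t, y)) has_derivative (\<lambda>h. (0, h))) (at x)"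
      by (auto intro!: derivative_eq_intros)
    from has_derivative_compose[OF this f]
    show "((\<lambda>y. \<phi> (t, y)) has_real_derivative fx (t, x)) (at x)"
      unfolding has_field_derivative_def by (rule has_derivative_eq_rhs) auto
  qed
  have i: "integrable lborel (\<lambda>p. ft p *\<^sub>R u (fst p) (snd p))"
    "integrable lborel (\<lambda>p. fx p *\<^sub>R u (fst p) (snd p))"
    "integrable lborel (\<lambda>p. (a * snd p * \<phi> p) *\<^sub>R u (fst p) (snd p))"
    by (rule compactly_supported_pairing_integrable[OF u _ K];
        use supp c in \<open>auto intro!: continuous_intros\<close>)+
  have "(LINT p|lborel. (ft p - fx p - a * snd p * \<phi> p) *\<^sub>R u (fst p) (snd p)) =
      pairing u ft - pairing u fx - (LINT p|lborel. (a * snd p * \<phi> p) *\<^sub>R u (fst p) (snd p))"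
    using i by (simp add: pairing_def scaleR_left_diff_distrib)
  also have "(LINT p|lborel. (a * snd p * \<phi> p) *\<^sub>R u (fst p) (snd p)) =
      pairing (\<lambda>t x. of_real (a * x) * u t x) \<phi>"
    unfolding pairing_def
    by (intro Bochner_Integration.integral_cong) (auto simp: scaleR_conv_of_real mult_ac)
  finally have "(LINT p|lborel. (ft p - fx p - a * snd p * \<phi> p) *\<^sub>R u (fst p) (snd p)) =
      dirac_operator a u \<phi> - distr_dt u \<phi>"
    by (simp add: dirac_operator_def distr_dt_def distr_dx_def dt dx case_prod_beta)
  then show ?thesis by auto
qed

text \<open>
  The operator \<open>\<partial>\<^sub>t - \<partial>\<^sub>x\<close> differentiates along the characteristics \<open>x + t = y\<close>.
\<close>

lemma derivative_along_characteristic: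
  assumes "compact_partials K \<phi> ft fx"
  shows "((\<lambda>t. \<phi> (t, y - t)) has_real_derivative (ft (t, y - t) - fx (t, y - t))) (at t)"
proof -
  have f: "(\<phi> has_derivative (\<lambda>h. fst h * ft p + snd h * fx p)) (at p)" for p
    using assms by (simp add: compact_partials_def del: split_paired_All)
  have "((\<lambda>s. (s, y - s)) has_derivative (\<lambda>h. (h, - h))) (at t)"
    by (auto intro!: derivative_eq_intros)
  from has_derivative_compose[OF this f]
  show ?thesis
    unfolding has_field_derivative_def by (rule has_derivative_eq_rhs) (auto simp: algebra_simps)
qed

section \<open>Conservation of moments along characteristics\<close>

lemma primitive_with_bounded_support:
  fixes b :: "real \<Rightarrow> real"
  assumes b: "continuous_on UNIV b" and supp: "\<And>t. t \<notin> {p..q} \<Longrightarrow> b t = 0"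
    and total: "(LINT t|lborel. b t) = 0"
  obtains \<alpha> where "\<And>t. (\<alpha> has_real_derivative b t) (at t)" "\<And>t. t \<notin> {p..q} \<Longrightarrow> \<alpha> t = 0"
proof
  define \<alpha> where "\<alpha> = (\<lambda>t. integral {p..t} b)"
  show "(\<alpha> has_real_derivative b t) (at t)" for t
  proof (cases "t < p")
    case True
    have "((\<lambda>t. 0) has_real_derivative b t) (at t)"
      using True supp[of t] by auto
    then show ?thesis
      by (rule has_field_derivative_transform_within_open[of _ _ _ "{..<p}"])
        (use True in \<open>auto simp: \<alpha>_def\<close>)
  next
    case False
    \<comment> \<open>Starting the primitive to the left of \<open>p\<close> makes \<open>t\<close> an interior point of the domain.\<close>
    define r where "r = p - 1"
    have eq: "integral {r..s} b = \<alpha> s" if "s > r" for s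
    proof -
      have "integral {r..s} b = integral UNIV (\<lambda>x. if x \<in> {r..s} then b x else 0)"
        by (rule integral_restrict_UNIV[symmetric])
      also have "(\<lambda>x. if x \<in> {r..s} then b x else 0) = (\<lambda>x. if x \<in> {p..s} then b x else 0)"
        using supp by (auto simp: r_def fun_eq_iff)
      also have "integral UNIV \<dots> = \<alpha> s"
        by (simp only: integral_restrict_UNIV \<alpha>_def)
      finally show ?thesis .
    qed
    have "((\<lambda>s. integral {r..s} b) has_real_derivative b t) (at t within {r..t + 1})"
      by (rule integral_has_real_derivative)
        (use False continuous_on_subset[OF b] in \<open>auto simp: r_def\<close>)
    then have "((\<lambda>s. integral {r..s} b) has_real_derivative b t) (at t)"
      using False at_within_Icc_at[of r t "t + 1"] by (simp add: r_def)
    then show ?thesis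
      by (rule has_field_derivative_transform_within_open[of _ _ _ "{r<..}"])
        (use False eq in \<open>auto simp: r_def\<close>)
  qed
  show "\<alpha> t = 0" if "t \<notin> {p..q}" for t
  proof (cases "t < p")
    case False
    have "integrable lborel (\<lambda>x. indicator {p..q} x *\<^sub>R b x)"
      by (intro borel_integrable_compact compact_Icc continuous_on_subset[OF b]) auto
    moreover have "(\<lambda>x. indicator {p..q} x *\<^sub>R b x) = b"
      using supp by (auto simp: indicator_def fun_eq_iff)
    ultimately have i: "integrable lborel b" by simp
    have "\<alpha> t = integral UNIV (\<lambda>x. if x \<in> {p..t} then b x else 0)"
      by (simp only: integral_restrict_UNIV \<alpha>_def)
    also have "(\<lambda>x. if x \<in> {p..t} then b x else 0) = b"
      using supp that False by (auto simp: fun_eq_iff)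
    also have "integral UNIV b = 0"
      using integral_lborel[OF i] total by simp
    finally show ?thesis .
  qed (simp add: \<alpha>_def)
qed

lemma C_k_primitive:
  assumes \<alpha>: "\<And>t. (\<alpha> has_real_derivative b t) (at t)" and b: "\<And>n. C_k n (\<lambda>p. b (fst p))"
  shows "C_k n (\<lambda>p. \<alpha> (fst p))"
proof -
  have h: "(\<alpha> has_derivative (\<lambda>y. y * b x)) (at x)" for x
    using \<alpha>[of x] unfolding has_field_derivative_def
    by (rule has_derivative_eq_rhs) (auto simp: mult.commute)
  have fst': "(fst has_derivative fst) (at p)" for p :: "real \<times> real"
    by (auto intro!: derivative_eq_intros)
  have "((\<lambda>p. \<alpha> (fst p)) has_derivative (\<lambda>h. fst h * (\<lambda>p. b (fst p)) p + snd h * (\<lambda>p. 0) p)) (at p)" for p :: "real \<times> real"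
    by (rule has_derivative_eq_rhs[OF has_derivative_compose[OF fst' h]]) auto
  then have "C_k (Suc n) (\<lambda>p. \<alpha> (fst p))"
    by (rule C_k_SucI) (rule b C_k_const)+
  then show ?thesis by (rule C_k_Suc_imp)
qed

text \<open>
  The weight \<open>E(t,x) = exp (a x t + a t\<^sup>2/2)\<close>, at the point \<open>(t,x)\<close>, that conjugates the equation
  into the transport equation; its reciprocal is the weight with \<open>-a\<close> in place of \<open>a\<close>.
\<close>

definition dirac_gauge :: "real \<Rightarrow> real \<times> real \<Rightarrow> real" where
  "dirac_gauge a p = exp (a * snd p * fst p + a * (fst p)\<^sup>2 / 2)"

lemma C_k_dirac_gauge: "C_k n (dirac_gauge a)"
proof -
  have "C_k n (\<lambda>p. a * (snd p * fst p) + (a / 2) * (fst p * fst p))" for n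
    by (intro C_k_add C_k_mult C_k_const C_k_fst C_k_snd)
  from C_k_compose[OF smooth_tower_exp this]
  have "C_k n (\<lambda>p. exp (a * (snd p * fst p) + (a / 2) * (fst p * fst p)))" .
  also have "(\<lambda>p. exp (a * (snd p * fst p) + (a / 2) * (fst p * fst p))) = dirac_gauge a"
    by (auto simp: dirac_gauge_def fun_eq_iff power2_eq_square)
  finally show ?thesis .
qed

lemma continuous_on_dirac_gauge: "continuous_on S (dirac_gauge a)"
  unfolding dirac_gauge_def by (intro continuous_intros) auto

lemma dirac_gauge_along_characteristic:
  "((\<lambda>t. dirac_gauge a (t, y - t)) has_real_derivative a * (y - t) * dirac_gauge a (t, y - t)) (at t)"
proof -
  have "((\<lambda>t. a * (y - t) * t + a * t\<^sup>2 / 2) has_real_derivative a * (y - t)) (at t)"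
    by (auto intro!: derivative_eq_intros simp: algebra_simps)
  then show ?thesis
    unfolding dirac_gauge_def by (auto intro!: derivative_eq_intros)
qed

text \<open>
  The integral of \<open>E u\<close> at time \<open>t\<close> against a bump function that is transported with the flow, that
  is, a function of \<open>x + t\<close>.
\<close>

definition moment :: "real \<Rightarrow> (real \<Rightarrow> real \<Rightarrow> complex) \<Rightarrow> nat \<Rightarrow> real \<Rightarrow> real \<Rightarrow> real \<Rightarrow> complex" where
  "moment a u n c d t = (LINT x|lborel. of_real (dirac_gauge a (t, x) * bump n c d (x + t)) * u t x)"

lemma continuous_on_moment:
  assumes "continuous_L2_loc u"
  shows "continuous_on {0..T} (moment a u n c d)"
proof -
  have "continuous_on {0..T} (\<lambda>t. LINT x|lborel.
      of_real ((\<lambda>p. dirac_gauge a p * bump n c d (snd p + fst p)) (t, x)) * u t x)"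
    by (rule weighted_slice_continuous[OF assms, where c="c - T" and d=d])
      (auto intro!: continuous_intros continuous_on_dirac_gauge bump_eq_0)
  then show ?thesis by (simp add: moment_def[abs_def])
qed

text \<open>
  The weak equation for the test function \<open>E(t,x) \<alpha>(t) \<beta>(x + t)\<close>, where \<open>\<alpha>' = b\<close>: the derivative of
  \<open>E\<close> cancels the potential term, and \<open>\<beta>\<close> is constant along characteristics, so that only the
  term with \<open>b\<close> remains. Smoothness of \<open>b\<close> is expressed on the plane, through \<open>b(t)\<close> as a function
  of \<open>(t,x)\<close>.
\<close>

lemma moment_orthogonal_to_derivatives:
  assumes u: "locally_integrable u"
    and weak: "\<And>\<phi>. test_function \<phi> \<Longrightarrow> dirac_operator a u \<phi> = distr_dt u \<phi>"
    and p: "0 < p"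
    and \<alpha>: "\<And>t. (\<alpha> has_real_derivative b t) (at t)" "\<And>t. t \<notin> {p..q} \<Longrightarrow> \<alpha> t = 0"
    and b: "\<And>n. C_k n (\<lambda>p. b (fst p))"
  shows "(LINT t|lborel. of_real (b t) * moment a u n c d t) = 0"
proof -
  define \<psi> where "\<psi> = (\<lambda>z. dirac_gauge a z * \<alpha> (fst z) * bump n c d (snd z + fst z))"
  define K where "K = {p..q} \<times> {c - q..d - p}"
  have bsupp: "b t = 0" if "t \<notin> {p..q}" for t
  proof -
    have "((\<lambda>t. 0) has_real_derivative b t) (at t)"
      by (rule has_field_derivative_transform_within_open[OF \<alpha>(1), of "- {p..q}"])
        (use that \<alpha>(2) in \<open>auto simp: open_Compl\<close>)
    then show ?thesis using DERIV_unique[of "\<lambda>t. 0" "b t" t 0] by simp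
  qed
  have K: "compact K" "K \<subseteq> {0<..} \<times> UNIV"
    using p by (auto simp: K_def intro: compact_Times)
  have K0: "fst z \<notin> {p..q} \<or> bump n c d (snd z + fst z) = 0" if "z \<notin> K" for z
    using that by (cases z) (auto simp: K_def intro!: bump_eq_0)
  have "C_k k \<psi>" for k
    unfolding \<psi>_def
    by (intro C_k_mult C_k_dirac_gauge C_k_primitive[OF \<alpha>(1) b] C_k_bump C_k_add C_k_fst C_k_snd)
  moreover have "\<psi> z = 0" if "z \<notin> K" for z
    using K0[OF that] \<alpha>(2) by (auto simp: \<psi>_def)
  ultimately have test: "test_function \<psi>"
    using K by (auto simp: test_function_def)
  obtain K' ft fx where P: "compact_partials K' \<psi> ft fx"
    using test_function_partials[OF test] .
  define g where "g = (\<lambda>z. b (fst z) * (dirac_gauge a z * bump n c d (snd z + fst z)))"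
  \<comment> \<open>The derivative of \<open>\<psi>\<close> along the characteristic through \<open>z\<close> is computed in two ways.\<close>
  have g: "ft z - fx z - a * snd z * \<psi> z = g z" for z
  proof -
    obtain t x where z: "z = (t, x)" by (cases z)
    define y where "y = x + t"
    have "((\<lambda>t. dirac_gauge a (t, y - t) * \<alpha> t * bump n c d y) has_real_derivative
        (a * (y - t) * dirac_gauge a (t, y - t) * \<alpha> t + b t * dirac_gauge a (t, y - t)) * bump n c d y) (at t)"
      by (auto intro!: derivative_eq_intros dirac_gauge_along_characteristic \<alpha>(1))
    moreover have "((\<lambda>t. dirac_gauge a (t, y - t) * \<alpha> t * bump n c d y) has_real_derivative
        ft (t, y - t) - fx (t, y - t)) (at t)"
      using derivative_along_characteristic[OF P, of y t] by (simp add: \<psi>_def)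
    ultimately have "ft (t, y - t) - fx (t, y - t) =
        (a * (y - t) * dirac_gauge a (t, y - t) * \<alpha> t + b t * dirac_gauge a (t, y - t)) * bump n c d y"
      by (rule DERIV_unique[symmetric])
    then show ?thesis by (simp add: z y_def g_def \<psi>_def algebra_simps)
  qed
  have zero: "(LINT z|lborel. g z *\<^sub>R u (fst z) (snd z)) = 0"
    using weak[OF test] weak_equation_iff[OF u P] by (simp add: g)
  have "C_k 0 (\<lambda>p. b (fst p))" by (rule b)
  then have cg: "continuous_on UNIV g"
    unfolding g_def by (auto intro!: continuous_intros continuous_on_dirac_gauge)
  have "integrable lborel (\<lambda>z. g z *\<^sub>R u (fst z) (snd z))"
    by (rule compactly_supported_pairing_integrable[OF u cg K])
      (use K0 bsupp in \<open>auto simp: g_def\<close>)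
  then have "(LINT t|lborel. LINT x|lborel. g (t, x) *\<^sub>R u t x) = (LINT z|lborel. g z *\<^sub>R u (fst z) (snd z))"
    using lborel_pair.integral_fst'[of "\<lambda>z. g z *\<^sub>R u (fst z) (snd z)"] by (simp add: lborel_prod)
  moreover have "(LINT x|lborel. g (t, x) *\<^sub>R u t x) = of_real (b t) * moment a u n c d t" for t
    unfolding moment_def g_def
    by (subst integral_mult_right_zero[symmetric]) (simp add: scaleR_conv_of_real mult_ac)
  ultimately show ?thesis using zero by simp
qed

lemma continuous_zero_interval_integrals:
  fixes w :: "real \<Rightarrow> complex"
  assumes w: "continuous_on {p..q} w" and pq: "p < q"
    and zero: "\<And>x. x \<in> {p..q} \<Longrightarrow> (LINT s:{p<..<x}|lborel. w s) = 0"
  shows "w p = 0"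
proof -
  have "integral {p..x} w = 0" if x: "x \<in> {p..q}" for x
  proof -
    have "set_integrable lborel {p..x} w"
      by (rule borel_integrable_atLeastAtMost') (use x in \<open>auto intro: continuous_on_subset[OF w]\<close>)
    then have "set_integrable lborel {p<..<x} w"
      by (rule set_integrable_subset) auto
    then have "integral {p<..<x} w = 0"
      using set_borel_integral_eq_integral(2) zero[OF x] by metis
    then show ?thesis using integral_open_interval_real[of p x w] by simp
  qed
  then have "((\<lambda>x. 0) has_vector_derivative w p) (at p within {p..q})"
    by (intro has_vector_derivative_transform[OF _ _ integral_has_vector_derivative[OF w]]) (use pq in auto)
  then show ?thesis
    using vector_derivative_unique_within_closed_interval[of p q p "\<lambda>x. 0" "w p" 0] pq by auto
qed

text \<open>
  The derivative \<open>b\<close> used here is a bump on \<open>[p,x]\<close> minus its translate by \<open>k\<close>. Its integral is zero,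
  so its primitive has bounded support and is admissible.
\<close>

lemma moment_translate:
  assumes u: "locally_integrable u" "continuous_L2_loc u"
    and weak: "\<And>\<phi>. test_function \<phi> \<Longrightarrow> dirac_operator a u \<phi> = distr_dt u \<phi>"
    and p: "0 < p" and k: "0 < k"
  shows "moment a u n c d p = moment a u n c d (p + k)"
proof -
  define F where "F = moment a u n c d"
  define w where "w = (\<lambda>t. F t - F (t + k))"
  have F: "continuous_on {p..p + 1 + k} F"
    unfolding F_def
    by (rule continuous_on_subset[OF continuous_on_moment[OF u(2), of "p + 1 + k"]]) (use p in auto)
  have Fk: "continuous_on {p..p+1} (\<lambda>t. F (t + k))"
    by (rule continuous_on_compose2[OF F]) (use k in \<open>auto intro!: continuous_intros\<close>)
  have F1: "continuous_on {p..p+1} F"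
    by (rule continuous_on_subset[OF F]) (use k in auto)
  have w: "continuous_on {p..p+1} w"
    unfolding w_def by (intro continuous_intros F1 Fk)
  have zero: "(LINT t|lborel. of_real (bump m p x t) * w t) = 0" if x: "x \<in> {p..p+1}" for m x
  proof -
    define b where "b = (\<lambda>t. bump m p x t - bump m (p + k) (x + k) t)"
    have shift: "bump m (p + k) (x + k) (t + k) = bump m p x t" for t
      by (simp add: bump_def algebra_simps)
    have cbump: "continuous_on UNIV (bump m c' d')" for c' d'
      by (intro continuous_intros)
    have ib: "integrable lborel (\<lambda>t. of_real (bump m c' d' t) * f t)"
      if f: "continuous_on {c'..d'} f" for c' d' and f :: "real \<Rightarrow> complex"
      using integrable_compact_support_scaleR[OF compact_Icc cbump borel_integrable_atLeastAtMost'[OF f] bump_eq_0]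
      by (simp add: scaleR_conv_of_real)
    have cb: "continuous_on UNIV b" unfolding b_def by (intro continuous_intros)
    have sb: "b t = 0" if "t \<notin> {p..x + k}" for t
      using that k by (auto simp: b_def bump_eq_0)
    have "integrable lborel (\<lambda>t. bump m c' d' t)" for c' d'
      using integrable_compact_support_scaleR[OF compact_Icc cbump _ bump_eq_0, of c' d' "\<lambda>t. 1::real" c' d']
        borel_integrable_atLeastAtMost'[of c' d' "\<lambda>t. 1::real"] by simp
    then have "(LINT t|lborel. b t) = (LINT t|lborel. bump m p x t) - (LINT t|lborel. bump m (p + k) (x + k) t)"
      unfolding b_def by simp
    also have "(LINT t|lborel. bump m (p + k) (x + k) t) = (LINT t|lborel. bump m p x t)"
      using lborel_integral_real_affine[of 1 "bump m (p + k) (x + k)" k]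
      by (simp add: shift add.commute[of k])
    finally have tb: "(LINT t|lborel. b t) = 0" by simp
    obtain \<alpha> where \<alpha>: "\<And>t. (\<alpha> has_real_derivative b t) (at t)" "\<And>t. t \<notin> {p..x + k} \<Longrightarrow> \<alpha> t = 0"
      using primitive_with_bounded_support[OF cb sb tb] by blast
    have "C_k i (\<lambda>z. bump m p x (fst z) + (- 1) * bump m (p + k) (x + k) (fst z))" for i
      by (intro C_k_add C_k_mult C_k_const C_k_bump C_k_fst)
    then have "C_k i (\<lambda>z. b (fst z))" for i by (simp add: b_def)
    from moment_orthogonal_to_derivatives[OF u(1) weak p \<alpha> this]
    have "0 = (LINT t|lborel. of_real (b t) * F t)" by (simp add: F_def)
    also have "\<dots> = (LINT t|lborel. of_real (bump m p x t) * F t - of_real (bump m (p + k) (x + k) t) * F t)"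
      by (simp add: b_def left_diff_distrib)
    also have "\<dots> = (LINT t|lborel. of_real (bump m p x t) * F t) - (LINT t|lborel. of_real (bump m (p + k) (x + k) t) * F t)"
      by (intro Bochner_Integration.integral_diff ib continuous_on_subset[OF F]) (use x k in auto)
    also have "(LINT t|lborel. of_real (bump m (p + k) (x + k) t) * F t) = (LINT t|lborel. of_real (bump m p x t) * F (t + k))"
      using lborel_integral_real_affine[of 1 "\<lambda>t. of_real (bump m (p + k) (x + k) t) * F t" k]
      by (simp add: shift add.commute[of k])
    also have "(LINT t|lborel. of_real (bump m p x t) * F t) - (LINT t|lborel. of_real (bump m p x t) * F (t + k))
        = (LINT t|lborel. of_real (bump m p x t) * F t - of_real (bump m p x t) * F (t + k))"
      by (intro Bochner_Integration.integral_diff[symmetric] ib continuous_on_subset[OF F1] continuous_on_subset[OF Fk]) (use x in auto)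
    finally show ?thesis by (simp add: w_def right_diff_distrib)
  qed
  have "w p = 0"
  proof (rule continuous_zero_interval_integrals[OF w])
    fix x assume x: "x \<in> {p..p + 1}"
    have "(\<lambda>m. LINT t|lborel. of_real (bump m p x t) * w t) \<longlonglongrightarrow> (LINT t:{p<..<x}|lborel. w t)"
      by (intro integral_bump_tendsto borel_integrable_atLeastAtMost' continuous_on_subset[OF w]) (use x in auto)
    then show "(LINT t:{p<..<x}|lborel. w t) = 0"
      using zero[OF x] by (simp add: LIMSEQ_const_iff)
  qed simp
  then show ?thesis by (simp add: w_def F_def)
qed

lemma moment_conserved:
  assumes u: "locally_integrable u" "continuous_L2_loc u"
    and weak: "\<And>\<phi>. test_function \<phi> \<Longrightarrow> dirac_operator a u \<phi> = distr_dt u \<phi>"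
    and t: "0 \<le> t"
  shows "moment a u n c d t = moment a u n c d 0"
proof (cases "t = 0")
  case False
  define F where "F = moment a u n c d"
  have Fc: "F s = F t" if "0 < s" "s < t" for s
    using moment_translate[OF u weak, of s "t - s"] that by (simp add: F_def)
  have "(F \<longlongrightarrow> F 0) (at 0 within {0..t})"
    using continuous_on_moment[OF u(2), of t a n c d] t by (simp add: continuous_on_def F_def)
  then have "(F \<longlongrightarrow> F 0) (at_right 0)"
    using False t at_within_Icc_at_right[of 0 t] by simp
  moreover have "\<forall>\<^sub>F s in at_right 0. F s = F t"
    using Fc False t by (auto simp: eventually_at_right_field intro!: exI[of _ t])
  ultimately have "((\<lambda>s. F t) \<longlongrightarrow> F 0) (at_right (0::real))"
    using tendsto_cong[of F "\<lambda>s. F t" "at_right 0" "F 0"] by simp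
  then show ?thesis by (simp add: F_def tendsto_const_iff)
qed simp

text \<open>
  A solution satisfies \<open>E(t,x) u(t,x) = u\<^sub>0(x + t)\<close> almost everywhere, at each time \<open>t\<close>.
\<close>

lemma solution_unique:
  assumes sol: "dirac_heat_solution a u0 u"
    and u0: "u0 \<in> borel_measurable borel" "\<And>c d. set_integrable lborel {c..d} u0"
    and t: "t \<ge> 0"
  shows "AE x in lborel. of_real (dirac_gauge a (t, x)) * u t x = u0 (x + t)"
proof -
  have u: "locally_integrable u" "continuous_L2_loc u"
    and weak: "\<And>\<phi>. test_function \<phi> \<Longrightarrow> dirac_operator a u \<phi> = distr_dt u \<phi>"
    and init: "AE x in lborel. u 0 x = u0 x"
    using sol by (auto simp: dirac_heat_solution_def)
  note [measurable] = u0(1)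
  define v where "v = (\<lambda>x. of_real (dirac_gauge a (t, x)) * u t x - u0 (x + t))"
  have ut: "set_integrable lborel {c..d} (\<lambda>x. of_real (dirac_gauge a (t, x)) * u t x)" for c d
  proof -
    have "continuous_on UNIV (\<lambda>x. dirac_gauge a (t, x))"
      by (intro continuous_on_compose2[OF continuous_on_dirac_gauge] continuous_intros) auto
    from set_integrable_continuous_scaleR[OF compact_Icc this slice_set_integrable[OF u(2) t]]
    show ?thesis by (simp add: scaleR_conv_of_real)
  qed
  have u0t: "set_integrable lborel {c..d} (\<lambda>x. u0 (x + t))" for c d
    by (rule translate_set_integrable[OF u0(2)])
  have v: "set_integrable lborel {c..d} v" for c d
    unfolding v_def by (intro set_integral_diff ut u0t)
  have bi: "integrable lborel (\<lambda>x. of_real (bump n c d x) * f x)" if "set_integrable lborel {c..d} f"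
    for n c d and f :: "real \<Rightarrow> complex"
  proof -
    have "continuous_on UNIV (bump n c d)" by (intro continuous_intros)
    from integrable_compact_support_scaleR[OF compact_Icc this that bump_eq_0]
    show ?thesis by (simp add: scaleR_conv_of_real)
  qed
  have zero: "(LINT x|lborel. of_real (bump n c d x) * v x) = 0" for n c d
  proof -
    have shift: "bump n (c + t) (d + t) (x + t) = bump n c d x" for x
      by (simp add: bump_def)
    have "(LINT x|lborel. of_real (bump n c d x) * (of_real (dirac_gauge a (t, x)) * u t x)) = moment a u n (c + t) (d + t) t"
      by (simp add: moment_def shift mult_ac)
    also have "\<dots> = moment a u n (c + t) (d + t) 0"
      by (rule moment_conserved[OF u weak t])
    also have "\<dots> = (LINT x|lborel. of_real (bump n (c + t) (d + t) x) * u 0 x)"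
      by (simp add: moment_def dirac_gauge_def)
    also have "\<dots> = (LINT x|lborel. of_real (bump n (c + t) (d + t) x) * u0 x)"
    proof (rule integral_cong_AE)
      show "(\<lambda>x. of_real (bump n (c + t) (d + t) x) * u 0 x) \<in> borel_measurable lborel"
      proof (rule borel_measurable_integrable, rule bi)
        show "set_integrable lborel {c + t..d + t} (u 0)"
          by (rule slice_set_integrable[OF u(2)]) simp
      qed
      show "AE x in lborel. of_real (bump n (c + t) (d + t) x) * u 0 x = of_real (bump n (c + t) (d + t) x) * u0 x"
        using init by eventually_elim simp
    qed measurable
    also have "\<dots> = (LINT x|lborel. of_real (bump n c d x) * u0 (x + t))"
      using lborel_integral_real_affine[of 1 "\<lambda>x. of_real (bump n (c + t) (d + t) x) * u0 x" t]
      by (simp add: shift add.commute[of t])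
    finally show ?thesis
      using bi[OF ut[of c d], of n] bi[OF u0t[of c d], of n] by (simp add: v_def right_diff_distrib)
  qed
  have "AE x in lborel. v x = 0"
  proof (rule AE_zero_if_interval_integrals_zero[OF v])
    fix c d
    show "(LINT x:{c<..<d}|lborel. v x) = 0"
      using integral_bump_tendsto[OF v, of c d] zero by (simp add: LIMSEQ_const_iff)
  qed
  then show ?thesis by eventually_elim (simp add: v_def)
qed

section \<open>The transported datum is a weak solution\<close>

lemma shear_set_integrable:
  fixes v :: "real \<Rightarrow> complex"
  assumes v: "v \<in> borel_measurable borel" "\<And>c d. set_integrable lborel {c..d} v" and K: "compact K"
  shows "set_integrable lborel K (\<lambda>p. v (snd p + k * fst p))"
proof -
  obtain R where R: "\<And>t x. (t, x) \<in> K \<Longrightarrow> \<bar>t\<bar> \<le> R \<and> \<bar>x\<bar> \<le> R"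
  proof -
    obtain R where R: "\<forall>p\<in>K. norm p \<le> R"
      using compact_imp_bounded[OF K] unfolding bounded_iff by (elim exE)
    have "\<bar>t\<bar> \<le> R \<and> \<bar>x\<bar> \<le> R" if "(t, x) \<in> K" for t x
      using R that norm_fst_le[of t x] norm_snd_le[of x t] by force
    then show ?thesis by (rule that)
  qed
  define S where "S = R + \<bar>k\<bar> * R"
  define w where "w = (\<lambda>x. indicator {- S..S} x *\<^sub>R v x)"
  have w: "integrable lborel w" using v(2) by (simp add: w_def set_integrable_def)
  note [measurable] = v(1)
  have [measurable]: "w \<in> borel_measurable borel" using w by auto
  define f where "f = (\<lambda>p. indicator {- R..R} (fst p) *\<^sub>R w (k * fst p + snd p))"
  have shift: "integrable lborel (\<lambda>x. w (r + x))" "(LINT x|lborel. norm (w (r + x))) = (LINT x|lborel. norm (w x))" for r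
    using lborel_integrable_real_affine[OF w, of 1 r] lborel_integral_real_affine[of 1 "\<lambda>x. norm (w x)" r] by auto
  have "integrable (lborel \<Otimes>\<^sub>M lborel) f"
  proof (rule lborel_pair.Fubini_integrable)
    show "f \<in> borel_measurable (lborel \<Otimes>\<^sub>M lborel)"
      unfolding f_def by measurable
    have "(\<lambda>t. LINT x|lborel. norm (f (t, x))) = (\<lambda>t. indicator {- R..R} t *\<^sub>R (LINT x|lborel. norm (w x)))"
      using shift(2) by (auto simp: f_def)
    then show "integrable lborel (\<lambda>t. LINT x|lborel. norm (f (t, x)))"
      using borel_integrable_compact[of "{- R..R}" "\<lambda>t. LINT x|lborel. norm (w x)"] by simp
    show "AE t in lborel. integrable lborel (\<lambda>x. f (t, x))"
      using shift(1) by (auto simp: f_def)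
  qed
  then have f: "integrable lborel f" by (simp add: lborel_prod)
  have "integrable lborel (\<lambda>p. indicator K p *\<^sub>R f p)"
    using f borel_compact[OF K] by (intro integrable_mult_indicator) auto
  moreover have "indicator K p *\<^sub>R f p = indicator K p *\<^sub>R v (snd p + k * fst p)" for p
  proof (cases "p \<in> K")
    case True
    then have "\<bar>fst p\<bar> \<le> R" "\<bar>snd p\<bar> \<le> R" using R[of "fst p" "snd p"] by auto
    moreover from this have "\<bar>k * fst p\<bar> \<le> \<bar>k\<bar> * R"
      by (simp add: abs_mult mult_left_mono)
    ultimately show ?thesis by (auto simp: f_def w_def S_def indicator_def add.commute)
  qed simp
  ultimately show ?thesis by (simp add: set_integrable_def)
qed

text \<open>
  The datum carried along the characteristics: \<open>u\<^sub>0(x + t) / E(t,x)\<close>.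
\<close>

definition transported :: "real \<Rightarrow> (real \<Rightarrow> complex) \<Rightarrow> real \<Rightarrow> real \<Rightarrow> complex" where
  "transported a u0 t x = of_real (dirac_gauge (- a) (t, x)) * u0 (x + t)"

lemma transported_locally_integrable:
  assumes "u0 \<in> borel_measurable borel" "\<And>c d. set_integrable lborel {c..d} u0"
  shows "locally_integrable (transported a u0)"
  unfolding locally_integrable_def
proof (intro allI impI)
  fix K :: "(real \<times> real) set" assume K: "compact K"
  have "set_integrable lborel K (\<lambda>p. dirac_gauge (- a) p *\<^sub>R u0 (snd p + 1 * fst p))"
    by (intro set_integrable_continuous_scaleR K continuous_on_dirac_gauge shear_set_integrable assms)
  then show "set_integrable lborel K (\<lambda>(t, x). transported a u0 t x)"
    by (simp add: transported_def case_prod_beta' scaleR_conv_of_real)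
qed

lemma transported_weak_solution:
  assumes u0: "u0 \<in> borel_measurable borel" "\<And>c d. set_integrable lborel {c..d} u0"
    and test: "test_function \<phi>"
  shows "dirac_operator a (transported a u0) \<phi> = distr_dt (transported a u0) \<phi>"
proof -
  obtain K ft fx where P: "compact_partials K \<phi> ft fx"
    using test_function_partials[OF test] .
  then have K: "compact K" "K \<subseteq> {0<..} \<times> UNIV"
    and cont: "continuous_on UNIV \<phi>" "continuous_on UNIV ft" "continuous_on UNIV fx"
    and supp: "\<And>p. p \<notin> K \<Longrightarrow> \<phi> p = 0" "\<And>p. p \<notin> K \<Longrightarrow> ft p = 0" "\<And>p. p \<notin> K \<Longrightarrow> fx p = 0"
    by (simp_all add: compact_partials_def del: split_paired_All)
  define G where "G = (\<lambda>p. ft p - fx p - a * snd p * \<phi> p)"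
  define H where "H = (\<lambda>p. G p * dirac_gauge (- a) p)"
  have cG: "continuous_on UNIV G" unfolding G_def by (intro continuous_intros cont)
  have cH: "continuous_on UNIV H" unfolding H_def by (intro continuous_intros cG continuous_on_dirac_gauge)
  have G0: "G p = 0" if "p \<notin> K" for p using supp that by (simp add: G_def)
  have H0: "H p = 0" if "p \<notin> K" for p using G0[OF that] by (simp add: H_def)
  obtain R where R: "\<And>p. p \<in> K \<Longrightarrow> norm p \<le> R"
  proof -
    obtain R where "\<forall>p\<in>K. norm p \<le> R"
      using compact_imp_bounded[OF K(1)] unfolding bounded_iff by (elim exE)
    then show ?thesis by (intro that) auto
  qed
  have out: "(t, x) \<notin> K" if "\<bar>t\<bar> > R" for t x
    using R[of "(t, x)"] norm_fst_le[of t x] that by force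
  define A where "A = \<bar>R\<bar> + 1"
  have restrict: "(\<lambda>t. indicator {- A..A} t *\<^sub>R H (t, y - t)) = (\<lambda>t. H (t, y - t))" for y
  proof
    fix t
    have "H (t, y - t) = 0" if "t \<notin> {- A..A}"
      by (intro H0 out) (use that in \<open>auto simp: A_def\<close>)
    then show "indicator {- A..A} t *\<^sub>R H (t, y - t) = H (t, y - t)"
      by (cases "t \<in> {- A..A}") auto
  qed
  have cHy: "continuous_on {- A..A} (\<lambda>t. H (t, y - t))" for y
    by (rule continuous_on_compose2[OF cH]) (auto intro!: continuous_intros)
  have int_H: "integrable lborel (\<lambda>t. H (t, y - t))" for y
    using borel_integrable_compact[OF compact_Icc cHy] by (simp only: restrict)
  have char: "(LINT t|lborel. H (t, y - t)) = 0" for y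
  proof -
    \<comment> \<open>\<open>Q\<close> is \<open>\<phi>/E\<close> along the characteristic; \<open>H\<close> restricted to it is the derivative of \<open>Q\<close>.\<close>
    define Q where "Q = (\<lambda>t. dirac_gauge (- a) (t, y - t) * \<phi> (t, y - t))"
    have "(Q has_real_derivative H (t, y - t)) (at t)" for t
      unfolding Q_def H_def G_def
      by (auto intro!: derivative_eq_intros dirac_gauge_along_characteristic derivative_along_characteristic[OF P]
          simp: algebra_simps)
    then have Q': "(Q has_vector_derivative H (t, y - t)) (at t within {- A..A})" for t
      by (simp add: has_real_derivative_iff_has_vector_derivative has_vector_derivative_at_within)
    have "(LINT t|lborel. indicator {- A..A} t *\<^sub>R H (t, y - t)) = Q A - Q (- A)"
      by (intro integral_FTC_atLeastAtMost Q' cHy) (auto simp: A_def)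
    also have "\<dots> = 0"
      using out supp(1) by (simp add: Q_def A_def)
    finally show ?thesis by (simp only: restrict)
  qed
  define f where "f = (\<lambda>t y. H (t, y - t) *\<^sub>R u0 y)"
  have int_f: "integrable lborel (\<lambda>p. f (fst p) (snd p))"
  proof -
    define K' where "K' = (\<lambda>p. (fst p, snd p + fst p)) ` K"
    have K': "compact K'"
      unfolding K'_def by (intro compact_continuous_image K continuous_intros)
    have c: "continuous_on UNIV (\<lambda>p. H (fst p, snd p - fst p))"
      by (rule continuous_on_compose2[OF cH]) (auto intro!: continuous_intros)
    have "set_integrable lborel K' (\<lambda>p. u0 (snd p + 0 * fst p))"
      by (rule shear_set_integrable[OF u0 K'])
    then have "integrable lborel (\<lambda>p. H (fst p, snd p - fst p) *\<^sub>R u0 (snd p + 0 * fst p))"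
    proof (rule integrable_compact_support_scaleR[OF K' c])
      fix p assume "p \<notin> K'"
      then have "(fst p, snd p - fst p) \<notin> K"
        unfolding K'_def by (force simp: image_iff)
      then show "H (fst p, snd p - fst p) = 0" by (rule H0)
    qed
    then show ?thesis by (simp add: f_def)
  qed
  have iG: "integrable lborel (\<lambda>p. G p *\<^sub>R transported a u0 (fst p) (snd p))"
    by (rule compactly_supported_pairing_integrable[OF transported_locally_integrable[OF u0] cG K G0])
  have "(LINT p|lborel. G p *\<^sub>R transported a u0 (fst p) (snd p)) =
      (LINT t|lborel. LINT x|lborel. G (t, x) *\<^sub>R transported a u0 t x)"
    using lborel_pair.integral_fst'[of "\<lambda>p. G p *\<^sub>R transported a u0 (fst p) (snd p)"] iG
    by (simp add: lborel_prod)
  also have "\<dots> = (LINT t|lborel. LINT y|lborel. f t y)"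
  proof (rule Bochner_Integration.integral_cong[OF refl])
    fix t
    have "(LINT x|lborel. G (t, x) *\<^sub>R transported a u0 t x) = (LINT x|lborel. f t (t + 1 * x))"
      by (intro Bochner_Integration.integral_cong)
        (auto simp: f_def H_def transported_def scaleR_conv_of_real mult_ac add.commute)
    then show "(LINT x|lborel. G (t, x) *\<^sub>R transported a u0 t x) = (LINT y|lborel. f t y)"
      using lborel_integral_real_affine[of 1 "f t" t] by simp
  qed
  also have "\<dots> = (LINT y|lborel. LINT t|lborel. f t y)"
    using lborel_pair.Fubini_integral[of f] int_f by (simp add: lborel_prod case_prod_beta')
  also have "\<dots> = 0"
    using char int_H by (simp add: f_def)
  finally show ?thesis
    using weak_equation_iff[OF transported_locally_integrable[OF u0] P, of a] by (simp add: G_def)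
qed

section \<open>Continuity in time of the transported datum\<close>

text \<open>
  Radial truncation: \<open>z\<close> is left unchanged if \<open>\<bar>z\<bar> \<le> N\<close>, and is otherwise projected to the circle of
  radius \<open>N\<close>. It makes the approximants bounded, hence dominated on bounded intervals.
\<close>

definition clip :: "real \<Rightarrow> complex \<Rightarrow> complex" where
  "clip N z = (N / max N (norm z)) *\<^sub>R z"

lemma norm_clip: "N > 0 \<Longrightarrow> norm (clip N z) \<le> N"
  by (auto simp: clip_def max_def field_simps)

lemma clip_eq: "N > 0 \<Longrightarrow> norm z \<le> N \<Longrightarrow> clip N z = z"
  by (auto simp: clip_def max_def)

lemma norm_diff_clip: "N > 0 \<Longrightarrow> norm (z - clip N z) \<le> norm z"
proof -
  assume N: "N > 0"
  have "z - clip N z = (1 - N / max N (norm z)) *\<^sub>R z"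
    by (simp add: clip_def scaleR_left_diff_distrib)
  moreover have "0 \<le> 1 - N / max N (norm z)" "1 - N / max N (norm z) \<le> 1"
    using N by (auto simp: field_simps)
  ultimately show ?thesis by (simp add: mult_left_le_one_le)
qed

lemma continuous_on_clip: "N > 0 \<Longrightarrow> continuous_on S (clip N)"
  unfolding clip_def by (intro continuous_intros) auto

text \<open>
  Density of the continuous functions in \<open>L\<^sup>2\<close> of an interval. A measurable function is an almost
  everywhere limit of continuous functions \<open>g n\<close>; for large \<open>N\<close> the function \<open>f\<close> is close to
  \<open>clip N f\<close>, and for large \<open>n\<close> the latter is close to the continuous function \<open>clip N (g n)\<close>.
\<close>

lemma L2_approx_continuous:
  fixes f :: "real \<Rightarrow> complex"
  assumes f: "f \<in> borel_measurable borel" and f2: "set_integrable lborel {c..d} (\<lambda>x. (cmod (f x))\<^sup>2)"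
    and e: "e > 0"
  obtains g where "continuous_on UNIV g" "(LINT x:{c..d}|lborel. (cmod (f x - g x))\<^sup>2) < e"
proof -
  note [measurable] = f
  let ?i = "indicat_real {c..d}"
  have fi: "integrable lborel (\<lambda>x. ?i x *\<^sub>R (cmod (f x))\<^sup>2)"
    using f2 by (simp add: set_integrable_def)
  have mclip: "clip N \<in> borel_measurable borel" if "N > 0" for N
    using that by (intro borel_measurable_continuous_onI continuous_on_clip)
  have "(\<lambda>n. LINT x|lborel. ?i x *\<^sub>R (cmod (f x - clip (real (Suc n)) (f x)))\<^sup>2) \<longlonglongrightarrow> (LINT x|(lborel::real measure). (0::real))"
  proof (rule integral_dominated_convergence[OF _ _ fi])
    show "(\<lambda>x. ?i x *\<^sub>R (cmod (f x - clip (real (Suc n)) (f x)))\<^sup>2) \<in> borel_measurable lborel" for n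
      using mclip[of "real (Suc n)"] by measurable
    show "AE x in lborel. (\<lambda>n. ?i x *\<^sub>R (cmod (f x - clip (real (Suc n)) (f x)))\<^sup>2) \<longlonglongrightarrow> 0"
    proof (intro AE_I2 tendsto_eventually)
      fix x
      obtain N :: nat where N: "norm (f x) < real N" using reals_Archimedean2 by blast
      have "?i x *\<^sub>R (cmod (f x - clip (real (Suc n)) (f x)))\<^sup>2 = 0" if "n \<ge> N" for n
        using clip_eq[of "real (Suc n)" "f x"] N that by simp
      then show "\<forall>\<^sub>F n in sequentially. ?i x *\<^sub>R (cmod (f x - clip (real (Suc n)) (f x)))\<^sup>2 = 0"
        unfolding eventually_at_top_linorder by blast
    qed
    show "AE x in lborel. norm (?i x *\<^sub>R (cmod (f x - clip (real (Suc n)) (f x)))\<^sup>2) \<le> ?i x *\<^sub>R (cmod (f x))\<^sup>2" for n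
      using norm_diff_clip[of "real (Suc n)"] by (intro AE_I2) (auto simp: indicator_def intro!: power_mono)
  qed auto
  then have "(\<lambda>n. LINT x|lborel. ?i x *\<^sub>R (cmod (f x - clip (real (Suc n)) (f x)))\<^sup>2) \<longlonglongrightarrow> 0" by simp
  then have "\<forall>\<^sub>F n in sequentially. (LINT x|lborel. ?i x *\<^sub>R (cmod (f x - clip (real (Suc n)) (f x)))\<^sup>2) < e / 4"
    by (rule order_tendstoD) (use e in simp)
  then obtain n0 where n0: "(LINT x|lborel. ?i x *\<^sub>R (cmod (f x - clip (real (Suc n0)) (f x)))\<^sup>2) < e / 4"
    by (auto simp: eventually_at_top_linorder)
  define N where "N = real (Suc n0)"
  have N: "N > 0" by (simp add: N_def)
  note [measurable] = mclip[OF N]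
  have "f \<in> borel_measurable (lebesgue_on UNIV)"
    using f by (simp add: lebesgue_on_UNIV_eq measurable_completion)
  then have "f measurable_on UNIV"
    by (simp add: measurable_on_iff_borel_measurable)
  then obtain Z g where Z: "negligible Z" and g: "\<And>n. continuous_on UNIV (g n)"
    and lim: "\<And>x. x \<notin> Z \<Longrightarrow> (\<lambda>n. g n x) \<longlonglongrightarrow> f x"
    by (auto simp: measurable_on_def)
  have cg: "continuous_on UNIV (\<lambda>x. clip N (g n x))" for n
    by (rule continuous_on_compose2[OF continuous_on_clip[OF N, of UNIV] g]) auto
  have mg: "(\<lambda>x. clip N (g n x)) \<in> borel_measurable borel" for n
    by (rule borel_measurable_continuous_onI[OF cg])
  have "AE x in lebesgue. x \<notin> Z"
    using Z by (auto simp: negligible_iff_null_sets intro: AE_not_in)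
  then have AEZ: "AE x in lborel. x \<notin> Z"
    by (simp add: AE_completion_iff)
  have bound: "(cmod (clip N y - clip N z))\<^sup>2 \<le> (2 * N)\<^sup>2" for y z
    using norm_triangle_ineq4[of "clip N y" "clip N z"] norm_clip[OF N, of y] norm_clip[OF N, of z]
    by (intro power_mono) auto
  have iN: "integrable lborel (\<lambda>x. ?i x *\<^sub>R (2 * N)\<^sup>2)"
    by (intro borel_integrable_compact compact_Icc continuous_intros)
  have m2: "(\<lambda>x. ?i x *\<^sub>R (cmod (clip N (f x) - clip N (g n x)))\<^sup>2) \<in> borel_measurable lborel" for n
    using mg[of n] by measurable
  have b2: "AE x in lborel. norm (?i x *\<^sub>R (cmod (clip N (f x) - clip N (g n x)))\<^sup>2) \<le> ?i x *\<^sub>R (2 * N)\<^sup>2" for n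
    using bound by (intro AE_I2) (auto simp: indicator_def)
  have "(\<lambda>n. LINT x|lborel. ?i x *\<^sub>R (cmod (clip N (f x) - clip N (g n x)))\<^sup>2) \<longlonglongrightarrow> (LINT x|(lborel::real measure). (0::real))"
  proof (rule integral_dominated_convergence[OF _ m2 iN _ b2])
    show "AE x in lborel. (\<lambda>n. ?i x *\<^sub>R (cmod (clip N (f x) - clip N (g n x)))\<^sup>2) \<longlonglongrightarrow> 0"
      using AEZ
    proof eventually_elim
      case (elim x)
      have "(\<lambda>n. clip N (g n x)) \<longlonglongrightarrow> clip N (f x)"
        by (rule continuous_on_tendsto_compose[OF continuous_on_clip[OF N, of UNIV] lim[OF elim]]) auto
      then have "(\<lambda>n. ?i x *\<^sub>R (cmod (clip N (f x) - clip N (g n x)))\<^sup>2) \<longlonglongrightarrow> ?i x *\<^sub>R (cmod (clip N (f x) - clip N (f x)))\<^sup>2"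
        by (intro tendsto_intros)
      then show ?case by simp
    qed
  qed auto
  then have "(\<lambda>n. LINT x|lborel. ?i x *\<^sub>R (cmod (clip N (f x) - clip N (g n x)))\<^sup>2) \<longlonglongrightarrow> 0" by simp
  then have "\<forall>\<^sub>F n in sequentially. (LINT x|lborel. ?i x *\<^sub>R (cmod (clip N (f x) - clip N (g n x)))\<^sup>2) < e / 4"
    by (rule order_tendstoD) (use e in simp)
  then obtain n where n: "(LINT x|lborel. ?i x *\<^sub>R (cmod (clip N (f x) - clip N (g n x)))\<^sup>2) < e / 4"
    by (auto simp: eventually_at_top_linorder)
  have i1: "integrable lborel (\<lambda>x. ?i x *\<^sub>R (cmod (f x - clip N (f x)))\<^sup>2)"
  proof (rule Bochner_Integration.integrable_bound[OF fi])
    show "AE x in lborel. norm (?i x *\<^sub>R (cmod (f x - clip N (f x)))\<^sup>2) \<le> norm (?i x *\<^sub>R (cmod (f x))\<^sup>2)"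
      using norm_diff_clip[OF N] by (intro AE_I2) (auto simp: indicator_def intro!: power_mono)
  qed measurable
  have i2: "integrable lborel (\<lambda>x. ?i x *\<^sub>R (cmod (clip N (f x) - clip N (g n x)))\<^sup>2)"
  proof (rule Bochner_Integration.integrable_bound[OF iN m2])
    show "AE x in lborel. norm (?i x *\<^sub>R (cmod (clip N (f x) - clip N (g n x)))\<^sup>2) \<le> norm (?i x *\<^sub>R (2 * N)\<^sup>2)"
      using bound by (intro AE_I2) (auto simp: indicator_def)
  qed
  have le: "?i x *\<^sub>R (cmod (f x - clip N (g n x)))\<^sup>2 \<le>
      2 * (?i x *\<^sub>R (cmod (f x - clip N (f x)))\<^sup>2) + 2 * (?i x *\<^sub>R (cmod (clip N (f x) - clip N (g n x)))\<^sup>2)" for x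
    using norm_add_square_le[of "f x - clip N (f x)" "clip N (f x) - clip N (g n x)"]
    by (auto simp: indicator_def)
  have "(LINT x:{c..d}|lborel. (cmod (f x - clip N (g n x)))\<^sup>2) \<le>
      (LINT x|lborel. 2 * (?i x *\<^sub>R (cmod (f x - clip N (f x)))\<^sup>2) + 2 * (?i x *\<^sub>R (cmod (clip N (f x) - clip N (g n x)))\<^sup>2))"
    unfolding set_lebesgue_integral_def
  proof (rule integral_mono')
    show "integrable lborel (\<lambda>x. 2 * (?i x *\<^sub>R (cmod (f x - clip N (f x)))\<^sup>2) + 2 * (?i x *\<^sub>R (cmod (clip N (f x) - clip N (g n x)))\<^sup>2))"
      using i1 i2 by (intro Bochner_Integration.integrable_add integrable_mult_right)
  qed (use le in auto)
  also have "\<dots> = 2 * (LINT x|lborel. ?i x *\<^sub>R (cmod (f x - clip N (f x)))\<^sup>2) + 2 * (LINT x|lborel. ?i x *\<^sub>R (cmod (clip N (f x) - clip N (g n x)))\<^sup>2)"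
    using i1 i2 by (simp only: Bochner_Integration.integral_add integrable_mult_right integral_mult_right_zero)
  also have "\<dots> < e"
    using n n0 by (simp add: N_def)
  finally show ?thesis by (rule that[OF cg])
qed

lemma translate_set_integral_le:
  fixes r :: "real \<Rightarrow> real"
  assumes r: "set_integrable lborel {c'..d'} r" "\<And>x. 0 \<le> r x"
    and sub: "c' \<le> c + t" "d + t \<le> d'"
  shows "(LINT x:{c..d}|lborel. r (x + t)) \<le> (LINT x:{c'..d'}|lborel. r x)"
proof -
  have "(LINT x:{c..d}|lborel. r (x + t)) = (LINT x|lborel. indicat_real {c + t..d + t} (t + 1 * x) *\<^sub>R r (t + 1 * x))"
    unfolding set_lebesgue_integral_def
    by (intro Bochner_Integration.integral_cong) (auto simp: indicator_def add.commute)
  also have "\<dots> = (LINT x|lborel. indicat_real {c + t..d + t} x *\<^sub>R r x)"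
    using lborel_integral_real_affine[of 1 "\<lambda>x. indicat_real {c + t..d + t} x *\<^sub>R r x" t] by simp
  also have "\<dots> \<le> (LINT x:{c'..d'}|lborel. r x)"
    unfolding set_lebesgue_integral_def
    by (rule integral_mono') (use r sub in \<open>auto simp: set_integrable_def indicator_def\<close>)
  finally show ?thesis .
qed

lemma transported_square_integrable:
  assumes u0: "u0 \<in> borel_measurable borel" "\<And>c d. set_integrable lborel {c..d} (\<lambda>x. (cmod (u0 x))\<^sup>2)"
    and K: "compact K"
  shows "square_integrable_on K (transported a u0 t)"
proof -
  note [measurable] = u0(1) borel_compact[OF K]
  have cg: "continuous_on UNIV (\<lambda>x. dirac_gauge (- a) (t, x))"
    by (intro continuous_on_compose2[OF continuous_on_dirac_gauge] continuous_intros) auto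
  have [measurable]: "(\<lambda>x. dirac_gauge (- a) (t, x)) \<in> borel_measurable borel"
    by (rule borel_measurable_continuous_onI[OF cg])
  have m: "transported a u0 t \<in> borel_measurable borel"
    unfolding transported_def by measurable
  obtain R where "K \<subseteq> {- R..R}"
    using compact_imp_bounded[OF K] unfolding bounded_iff by (auto simp: abs_le_iff subset_iff minus_le_iff)
  have "set_integrable lborel {- R..R} (\<lambda>x. (dirac_gauge (- a) (t, x))\<^sup>2 *\<^sub>R (cmod (u0 (x + t)))\<^sup>2)"
    by (intro set_integrable_continuous_scaleR compact_Icc continuous_intros cg translate_set_integrable[of "\<lambda>x. (cmod (u0 x))\<^sup>2"] u0)
  then have "set_integrable lborel {- R..R} (\<lambda>x. (cmod (transported a u0 t x))\<^sup>2)"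
    by (simp add: transported_def norm_mult power_mult_distrib)
  then have "set_integrable lborel K (\<lambda>x. (cmod (transported a u0 t x))\<^sup>2)"
    by (rule set_integrable_subset) (use \<open>K \<subseteq> {- R..R}\<close> K in \<open>auto intro: borel_compact\<close>)
  then show ?thesis
    using m by (simp add: square_integrable_on_def set_borel_measurable_def)
qed

text \<open>
  With \<open>u\<^sub>0 = g + r\<close>, where \<open>g\<close> is continuous and \<open>r\<close> is small in \<open>L\<^sup>2\<close>, the solution splits as
  \<open>U = V + W\<close> into the transported data of \<open>g\<close> and \<open>r\<close>. The part \<open>V\<close> is jointly continuous, and \<open>W\<close> is
  small in \<open>L\<^sup>2\<close>, uniformly for times within distance 1 of \<open>s\<close>.
\<close>

lemma transported_continuous_L2_loc:
  assumes u0: "u0 \<in> borel_measurable borel" "\<And>c d. set_integrable lborel {c..d} (\<lambda>x. (cmod (u0 x))\<^sup>2)"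
  shows "continuous_L2_loc (transported a u0)"
  unfolding continuous_L2_loc_def
proof (intro allI impI conjI)
  fix K :: "real set" assume K: "compact K"
  show "square_integrable_on K (transported a u0 t)" for t
    by (rule transported_square_integrable[OF u0 K])
  fix s :: real assume "s \<ge> 0"
  let ?U = "transported a u0"
  have sq: "square_integrable_on {c..d} (?U t)" for c d t
    by (rule transported_square_integrable[OF u0 compact_Icc])
  obtain R where R: "K \<subseteq> {- R..R}"
    using compact_imp_bounded[OF K] unfolding bounded_iff by (auto simp: abs_le_iff subset_iff minus_le_iff)
  define c where "c = - R"
  define d where "d = R"
  let ?F = "at s within {0..}"
  obtain M where "\<forall>z\<in>{s - 1..s + 1} \<times> {c..d}. norm (dirac_gauge (- a) z) \<le> M"
    using bounded_on_compact[OF continuous_on_dirac_gauge[of UNIV "- a"] compact_Times[OF compact_Icc[of "s - 1" "s + 1"] compact_Icc[of c d]]]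
    by (elim exE)
  then have M: "\<bar>dirac_gauge (- a) (t, x)\<bar> \<le> M" if "t \<in> {s - 1..s + 1}" "x \<in> {c..d}" for t x
    using that by auto
  show "((\<lambda>t. LINT x:K|lborel. (cmod (?U t x - ?U s x))\<^sup>2) \<longlongrightarrow> 0) ?F"
  proof (rule tendstoI)
    fix e :: real assume e: "e > 0"
    \<comment> \<open>By \<open>\<bar>x + y\<bar>\<^sup>2 \<le> 2 \<bar>x\<bar>\<^sup>2 + 2 \<bar>y\<bar>\<^sup>2\<close>, applied twice, the two \<open>W\<close>-terms enter with a factor 4 and
      the \<open>V\<close>-term with a factor 2; bounds of \<open>e / 12\<close> and \<open>e / 6\<close> on them are enough.\<close>
    define \<epsilon> where "\<epsilon> = e / (16 * (M\<^sup>2 + 1))"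
    have \<epsilon>: "\<epsilon> > 0" "M\<^sup>2 * \<epsilon> < e / 12"
    proof -
      have "16 * (M\<^sup>2 + 1) > 0" by (simp add: add_nonneg_pos)
      then show "\<epsilon> > 0" using e by (simp add: \<epsilon>_def)
      have "M\<^sup>2 * \<epsilon> = e / 16 * (M\<^sup>2 / (M\<^sup>2 + 1))" by (simp add: \<epsilon>_def)
      also have "\<dots> \<le> e / 16 * 1"
        by (intro mult_left_mono) (use e in \<open>auto simp: divide_le_eq add_nonneg_pos\<close>)
      finally show "M\<^sup>2 * \<epsilon> < e / 12" using e by simp
    qed
    \<comment> \<open>This interval contains all translates of \<open>[c,d]\<close> by times in \<open>[s - 1, s + 1]\<close>.\<close>
    define c' where "c' = c + s - 1"
    define d' where "d' = d + s + 1"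
    obtain g where g: "continuous_on UNIV g"
      and gl: "(LINT x:{c'..d'}|lborel. (cmod (u0 x - g x))\<^sup>2) < \<epsilon>"
      using L2_approx_continuous[OF u0 \<epsilon>(1)] .
    let ?V = "transported a g"
    have mg: "g \<in> borel_measurable borel" by (rule borel_measurable_continuous_onI[OF g])
    have "continuous_on UNIV (\<lambda>x. (cmod (g x))\<^sup>2)" by (intro continuous_intros g)
    then have g2: "set_integrable lborel {c..d} (\<lambda>x. (cmod (g x))\<^sup>2)" for c d
      by (intro borel_integrable_atLeastAtMost') (rule continuous_on_subset[OF _ subset_UNIV])
    define r where "r = (\<lambda>x. u0 x - g x)"
    have mr: "r \<in> borel_measurable borel" using u0(1) mg unfolding r_def by measurable
    have r2: "set_integrable lborel {c..d} (\<lambda>x. (cmod (r x))\<^sup>2)" for c d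
    proof -
      have "square_integrable_on {c..d} (\<lambda>x. u0 x - g x)"
        by (rule square_integrable_diff)
          (use u0 mg g2 in \<open>auto simp: square_integrable_on_def set_borel_measurable_def\<close>)
      then show ?thesis by (simp add: square_integrable_on_def r_def)
    qed
    let ?W = "transported a r"
    have Wi: "set_integrable lborel {c..d} (\<lambda>x. (cmod (?W t x))\<^sup>2)" for c d t
      using transported_square_integrable[OF mr r2 compact_Icc] by (simp add: square_integrable_on_def)
    have W: "(LINT x:{c..d}|lborel. (cmod (?W t x))\<^sup>2) \<le> e / 12" if t: "t \<in> {s - 1..s + 1}" for t
    proof -
      have r2t: "set_integrable lborel {c..d} (\<lambda>x. (cmod (r (x + t)))\<^sup>2)"
        by (rule translate_set_integrable[of "\<lambda>x. (cmod (r x))\<^sup>2", OF r2])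
      have "(LINT x:{c..d}|lborel. (cmod (?W t x))\<^sup>2) \<le> (LINT x:{c..d}|lborel. M\<^sup>2 * (cmod (r (x + t)))\<^sup>2)"
      proof (rule set_integral_mono[OF Wi])
        show "set_integrable lborel {c..d} (\<lambda>x. M\<^sup>2 * (cmod (r (x + t)))\<^sup>2)"
          using r2t by simp
        fix x assume "x \<in> {c..d}"
        then have "\<bar>dirac_gauge (- a) (t, x)\<bar>\<^sup>2 \<le> M\<^sup>2"
          using M[OF t] by (intro power_mono) auto
        then show "(cmod (?W t x))\<^sup>2 \<le> M\<^sup>2 * (cmod (r (x + t)))\<^sup>2"
          by (simp add: transported_def norm_mult power_mult_distrib mult_right_mono)
      qed
      also have "\<dots> = M\<^sup>2 * (LINT x:{c..d}|lborel. (cmod (r (x + t)))\<^sup>2)" by simp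
      also have "\<dots> \<le> M\<^sup>2 * (LINT x:{c'..d'}|lborel. (cmod (r x))\<^sup>2)"
        by (intro mult_left_mono translate_set_integral_le[of c' d' "\<lambda>x. (cmod (r x))\<^sup>2", OF r2])
          (use t in \<open>auto simp: c'_def d'_def\<close>)
      also have "\<dots> \<le> M\<^sup>2 * \<epsilon>"
        using gl by (intro mult_left_mono) (auto simp: r_def)
      finally show ?thesis using \<epsilon>(2) by simp
    qed
    define D where "D = (\<lambda>t. integral {c..d} (\<lambda>x. (cmod (?V t x - ?V s x))\<^sup>2))"
    have cV: "continuous_on UNIV (\<lambda>z. ?V (fst z) (snd z))"
      unfolding transported_def
      by (intro continuous_intros continuous_on_compose2[OF g] continuous_on_compose2[OF continuous_on_dirac_gauge]) auto
    have cVs: "continuous_on UNIV (\<lambda>z::real \<times> real. ?V s (snd z))"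
    proof -
      have "continuous_on UNIV (\<lambda>z::real \<times> real. (s, snd z))" by (intro continuous_intros)
      from continuous_on_compose2[OF cV this] show ?thesis by simp
    qed
    have cVV: "continuous_on UNIV (\<lambda>z. (cmod (?V (fst z) (snd z) - ?V s (snd z)))\<^sup>2)"
      by (intro continuous_intros cV cVs)
    have "continuous_on (UNIV \<times> cbox c d) (\<lambda>(t, x). (cmod (?V t x - ?V s x))\<^sup>2)"
      unfolding case_prod_beta' by (rule continuous_on_subset[OF cVV subset_UNIV])
    then have "continuous_on UNIV D"
      unfolding D_def box_real[symmetric] by (rule integral_continuous_on_param)
    then have "(D \<longlongrightarrow> D s) (at s)" by (simp add: continuous_on_def)
    then have "(D \<longlongrightarrow> D s) ?F" by (rule tendsto_within_subset) auto
    moreover have "D s = 0" by (simp add: D_def)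
    ultimately have "\<forall>\<^sub>F t in ?F. D t < e / 6"
      using e by (intro order_tendstoD(2)[of D "D s"]) auto
    moreover have "\<forall>\<^sub>F t in ?F. t \<in> {s - 1..s + 1}"
      unfolding eventually_at by (rule exI[of _ 1]) (auto simp: dist_real_def)
    ultimately show "\<forall>\<^sub>F t in ?F. dist (LINT x:K|lborel. (cmod (?U t x - ?U s x))\<^sup>2) 0 < e"
    proof eventually_elim
      case (elim t)
      have Ui: "set_integrable lborel {c..d} (\<lambda>x. (cmod (?U t x - ?U s x))\<^sup>2)"
        using square_integrable_diff[OF _ sq sq, of c d t s] by (simp add: square_integrable_on_def)
      have Vc: "continuous_on {c..d} (\<lambda>x. (cmod (?V t x - ?V s x))\<^sup>2)"
      proof -
        have "continuous_on {c..d} (\<lambda>x. (t, x))" by (intro continuous_intros)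
        from continuous_on_compose2[OF cVV this] show ?thesis by simp
      qed
      note Vi = borel_integrable_atLeastAtMost'[OF Vc]
      have "(LINT x:K|lborel. (cmod (?U t x - ?U s x))\<^sup>2) \<le> (LINT x:{c..d}|lborel. (cmod (?U t x - ?U s x))\<^sup>2)"
        unfolding set_lebesgue_integral_def
        by (rule integral_mono') (use Ui R in \<open>auto simp: set_integrable_def indicator_def c_def d_def\<close>)
      also have "\<dots> \<le> (LINT x:{c..d}|lborel. 2 * (cmod (?V t x - ?V s x))\<^sup>2 + (4 * (cmod (?W t x))\<^sup>2 + 4 * (cmod (?W s x))\<^sup>2))"
      proof (rule set_integral_mono[OF Ui])
        show "set_integrable lborel {c..d} (\<lambda>x. 2 * (cmod (?V t x - ?V s x))\<^sup>2 + (4 * (cmod (?W t x))\<^sup>2 + 4 * (cmod (?W s x))\<^sup>2))"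
          by (intro set_integral_add set_integrable_mult_right Vi Wi)
        fix x
        have "?U t x - ?U s x = (?V t x - ?V s x) + (?W t x + (- ?W s x))"
          by (simp add: transported_def r_def algebra_simps)
        then show "(cmod (?U t x - ?U s x))\<^sup>2 \<le> 2 * (cmod (?V t x - ?V s x))\<^sup>2 + (4 * (cmod (?W t x))\<^sup>2 + 4 * (cmod (?W s x))\<^sup>2)"
          using norm_add_square_le[of "?V t x - ?V s x" "?W t x + (- ?W s x)"] norm_add_square_le[of "?W t x" "- ?W s x"]
          by simp
      qed
      also have "\<dots> = 2 * D t + (4 * (LINT x:{c..d}|lborel. (cmod (?W t x))\<^sup>2) + 4 * (LINT x:{c..d}|lborel. (cmod (?W s x))\<^sup>2))"
        using Vi Wi[of c d] set_borel_integral_eq_integral(2)[OF Vi]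
        by (simp add: set_integral_add set_integrable_mult_right D_def)
      also have "\<dots> < e"
        using W[of t] W[of s] elim by simp
      finally have "(LINT x:K|lborel. (cmod (?U t x - ?U s x))\<^sup>2) < e" .
      moreover have "0 \<le> (LINT x:K|lborel. (cmod (?U t x - ?U s x))\<^sup>2)"
        by (auto simp: set_lebesgue_integral_def intro!: integral_nonneg_AE)
      ultimately show ?case by simp
    qed
  qed
qed

section \<open>The solution formula\<close>

theorem theorem3p2:
  fixes a :: real and u\<^sub>0 :: "real \<Rightarrow> complex" and U :: "real \<Rightarrow> real \<Rightarrow> complex"
  defines "U \<equiv> \<lambda>t x. of_real (exp (- a * x * t) * exp (- a * t\<^sup>2 / 2)) * u\<^sub>0 (x + t)"
  assumes "a > 0" and "square_integrable_on UNIV u\<^sub>0"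
  shows "dirac_heat_solution a u\<^sub>0 U \<and>
         (\<forall>u. dirac_heat_solution a u\<^sub>0 u \<longrightarrow> (\<forall>t\<ge>0. AE x in lborel. u t x = U t x))"
proof -
  have U: "U = transported a u\<^sub>0"
    by (auto simp: U_def transported_def dirac_gauge_def fun_eq_iff exp_add[symmetric] algebra_simps)
  have m: "u\<^sub>0 \<in> borel_measurable borel"
    using assms(3) by (simp add: square_integrable_on_def set_borel_measurable_def)
  have u2: "set_integrable lborel {c..d} (\<lambda>x. (cmod (u\<^sub>0 x))\<^sup>2)" for c d
  proof (rule set_integrable_subset)
    show "set_integrable lborel UNIV (\<lambda>x. (cmod (u\<^sub>0 x))\<^sup>2)"
      using assms(3) by (simp only: square_integrable_on_def)
  qed auto
  have u1: "set_integrable lborel {c..d} u\<^sub>0" for c d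
    by (rule square_integrable_imp_set_integrable)
      (use m u2 in \<open>auto simp: square_integrable_on_def set_borel_measurable_def\<close>)
  have "dirac_heat_solution a u\<^sub>0 U"
    unfolding dirac_heat_solution_def U
    by (intro conjI allI impI transported_locally_integrable transported_continuous_L2_loc transported_weak_solution m u1 u2)
      (simp_all add: transported_def dirac_gauge_def)
  moreover have "AE x in lborel. u t x = U t x" if "dirac_heat_solution a u\<^sub>0 u" "t \<ge> 0" for u t
    using solution_unique[OF that(1) m u1 that(2)]
  proof eventually_elim
    case (elim x)
    have "dirac_gauge (- a) (t, x) * dirac_gauge a (t, x) = 1"
      by (simp add: dirac_gauge_def exp_add[symmetric])
    then have "of_real (dirac_gauge (- a) (t, x)) * (of_real (dirac_gauge a (t, x)) * u t x) = u t x"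
      by (simp flip: mult.assoc of_real_mult)
    with elim show ?case by (simp add: U transported_def)
  qed
  ultimately show ?thesis by blast
qed

end
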